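(* Let $\mathbf P$ and $\mathbf Q$ be shift-invariant Borel probability measures on $\mathcal A^{\mathbf N}$, where $\mathcal A$ is a finite set. Suppose that $\mathbf P$ is selectively lower decoupled (SLD) and upper decoupled (UD), that $\mathbf Q$ is upper decoupled (UD), that the pair $(\mathbf P,\mathbf Q)$ is nondegenerate (ND), i.e. $\overline q(-1)<0$, and that $\operatorname{supp}\mathbf Q\subseteq\operatorname{supp}\mathbf P$. Suppose in addition that $q(\alpha)=\lim_{n\to\infty}\frac1nq_n(\alpha)$ exists as a finite limit for all $\alpha$ in an open interval containing the origin, and that $q$ is differentiable at the origin. Then $$\lim_{N\to\infty}Q_N(y,x)=h_{\mathrm c}(\mathbf Q|\mathbf P)$$ for $(\mathbf P\otimes\mathbf Q)$-almost every $(x,y)$, where $Q_N$ is the modified Ziv--Merhav estimator and $h_{\mathrm c}(\mathbf Q|\mathbf P)$ the specific cross entropy.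
   Context: Notation. $\mathcal A$ is a finite set, $\mathbf N=\{1,2,\dots\}$, $\mathcal A^{\mathbf N}$ carries the product ($=$ Borel) $\sigma$-algebra, and $T$ is the left shift. For $x=(x_k)_{k\ge1}$ write $x_i^j=x_ix_{i+1}\cdots x_j$. For $a\in\mathcal A^n$, $[a]=\{x: x_1^n=a\}$ and $\mathbf P[a]=\mathbf P([a])$; for the empty word $\mathbf P[\emptyset]=1$. $\operatorname{supp}\mathbf P_n=\{a\in\mathcal A^n:\mathbf P[a]>0\}$ (for $n=0$, the empty word only) and $\operatorname{supp}\mathbf P=\{x:\mathbf P[x_1^n]>0\text{ for all }n\}$; similarly for $\mathbf Q$. UD: $\mathbf P$ is upper decoupled if there are a nonnegative sequence $(k_n)_{n\ge1}$ with $k_n=o(n)$ and an integer $\tau\ge0$ such that for all $n,m\in\mathbf N$, $a\in\operatorname{supp}\mathbf P_n$, $\xi\in\operatorname{supp}\mathbf P_\tau$, $b\in\operatorname{supp}\mathbf P_m$: $\mathbf P[a\xi b]\le e^{k_n}\mathbf P[a]\mathbf P[b]$. SLD: $\mathbf P$ is selectively lower decoupled if there are a nonnegative sequence $(k_n)_{n\ge1}$ with $k_n=o(n)$ and an integer $\tau\ge0$ such that for all $n,m\in\mathbf N$, $a\in\operatorname{supp}\mathbf P_n$, $b\in\operatorname{supp}\mathbf P_m$ there exist $0\le\ell\le\tau$ and $\xi\in\operatorname{supp}\mathbf P_\ell$ with $\mathbf P[a\xi b]\ge e^{-k_n}\mathbf P[a]\mathbf P[b]$. Cross-entropic pressure: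 $q_n(\alpha)=\ln\sum_{a\in\operatorname{supp}\mathbf P_n}\mathbf P[a]^{-\alpha}\,\mathbf Q[a]$ and $\overline q(\alpha)=\limsup_{n\to\infty}\frac1n q_n(\alpha)$; $q(\alpha)$ denotes the limit when it exists. Cross entropy: $h_{\mathrm c}(\mathbf Q|\mathbf P)=\lim_{n\to\infty}-\frac1n\sum_{a\in\mathcal A^n}\mathbf Q[a]\ln\mathbf P[a]$ (the limit exists in $[0,\infty]$ when $\mathbf P$ satisfies UD; terms with $\mathbf Q[a]=0$ are $0$). Modified Ziv--Merhav (mZM) parsing of $y_1^N$ with respect to $x_1^N$: the first word is the shortest prefix of $y_1^N$ that does not appear as a contiguous substring of $x_1^N$, or all of $y_1^N$ if no such prefix exists (in which case the procedure terminates). Given that the first $i$ words have lengths summing to $L_i<N$, the next word is the shortest prefix of $y_{L_i+1}^N$ that does not appear as a contiguous substring of $x_1^N$, or all of $y_{L_i+1}^N$ if no such prefix exists (in which case the procedure terminates). The procedure stops once all of $y_1^N$ is parsed. $c_N=c_N(y|x)$ is the number of words, and $Q_N(y,x)=\frac{c_N(y|x)\ln N}{N-c_N(y|x)}$ (understood as $+\infty$ if $c_N=N$). *)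

theory Defs
  imports "HOL-Probability.Probability" "HOL-Library.Landau_Symbols" "HOL-Library.Sublist"
begin

text \<open>
  The finite alphabet is a type of class finite, one-sided sequences are streams
  (so that the prefix of length n of x is stake n x, and the left shift is stl), and words are lists.
\<close>

abbreviation seq_space :: "'a stream measure" where
  "seq_space \<equiv> stream_space (count_space UNIV)"

definition shift_invariant :: "'a stream measure \<Rightarrow> bool" where
  "shift_invariant P \<longleftrightarrow> distr P seq_space stl = P"

definition cylinder :: "'a list \<Rightarrow> 'a stream set" where
  "cylinder a = {x. stake (length a) x = a}"

definition word_prob :: "'a stream measure \<Rightarrow> 'a list \<Rightarrow> real" where
  "word_prob P a = measure P (cylinder a)"

definition supp_words :: "'a stream measure \<Rightarrow> nat \<Rightarrow> 'a list set" where
  "supp_words P n = {a. length a = n \<and> word_prob P a > 0}"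

definition supp :: "'a stream measure \<Rightarrow> 'a stream set" where
  "supp P = {x. \<forall>n. word_prob P (stake n x) > 0}"

definition upper_decoupled :: "'a stream measure \<Rightarrow> bool" where
  "upper_decoupled P \<longleftrightarrow>
    (\<exists>(k :: nat \<Rightarrow> real) (\<tau> :: nat). (\<forall>n\<ge>1. k n \<ge> 0) \<and> k \<in> o(\<lambda>n. real n) \<and>
      (\<forall>n\<ge>1. \<forall>m\<ge>1. \<forall>a\<in>supp_words P n. \<forall>\<xi>\<in>supp_words P \<tau>. \<forall>b\<in>supp_words P m.
        word_prob P (a @ \<xi> @ b) \<le> exp (k n) * word_prob P a * word_prob P b))"

definition selectively_lower_decoupled :: "'a stream measure \<Rightarrow> bool" where
  "selectively_lower_decoupled P \<longleftrightarrow>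
    (\<exists>(k :: nat \<Rightarrow> real) (\<tau> :: nat). (\<forall>n\<ge>1. k n \<ge> 0) \<and> k \<in> o(\<lambda>n. real n) \<and>
      (\<forall>n\<ge>1. \<forall>m\<ge>1. \<forall>a\<in>supp_words P n. \<forall>b\<in>supp_words P m. \<exists>l\<le>\<tau>. \<exists>\<xi>\<in>supp_words P l.
        word_prob P (a @ \<xi> @ b) \<ge> exp (- k n) * word_prob P a * word_prob P b))"

text \<open>Logarithm of a nonnegative real with the value minus infinity at 0 (in HOL, ln 0 = 0).\<close>

definition eln :: "real \<Rightarrow> ereal" where
  "eln t = (if t = 0 then - \<infinity> else ereal (ln t))"

definition pressure_n :: "'a stream measure \<Rightarrow> 'a stream measure \<Rightarrow> nat \<Rightarrow> real \<Rightarrow> ereal" where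
  "pressure_n P Q n \<alpha> = eln (\<Sum>a\<in>supp_words P n. word_prob P a powr (- \<alpha>) * word_prob Q a)"

definition upper_pressure :: "'a stream measure \<Rightarrow> 'a stream measure \<Rightarrow> real \<Rightarrow> ereal" where
  "upper_pressure P Q \<alpha> = limsup (\<lambda>n. pressure_n P Q n \<alpha> / ereal (real n))"

definition nondegenerate :: "'a stream measure \<Rightarrow> 'a stream measure \<Rightarrow> bool" where
  "nondegenerate P Q \<longleftrightarrow> upper_pressure P Q (-1) < 0"

text \<open>
  Specific cross entropy of Q relative to P (written with the arguments in this order).
  Since 0 times infinity is 0 in ereal, words of Q-probability 0 contribute 0.
\<close>

definition cross_entropy :: "'a stream measure \<Rightarrow> 'a stream measure \<Rightarrow> ereal" where
  "cross_entropy Q P =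
    lim (\<lambda>n. (\<Sum>a | length a = n. ereal (word_prob Q a) * (- eln (word_prob P a))) / ereal (real n))"

text \<open>
  Next word in the modified Ziv--Merhav parsing of ys with respect to xs;
  the relation sublist of the library refers to contiguous substrings.
\<close>

definition mzm_word :: "'a list \<Rightarrow> 'a list \<Rightarrow> 'a list" where
  "mzm_word xs ys =
    (if \<exists>k\<le>length ys. \<not> sublist (take k ys) xs
     then take (LEAST k. \<not> sublist (take k ys) xs) ys
     else ys)"

lemma mzm_word_nonempty:
  assumes "ys \<noteq> []"
  shows "mzm_word xs ys \<noteq> []"
proof (cases "\<exists>k\<le>length ys. \<not> sublist (take k ys) xs")
  case True
  then have "\<not> sublist (take (LEAST k. \<not> sublist (take k ys) xs) ys) xs"
    by (metis (mono_tags, lifting) LeastI)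
  then have "take (LEAST k. \<not> sublist (take k ys) xs) ys \<noteq> []"
    by (metis sublist_Nil_left)
  then show ?thesis
    using True unfolding mzm_word_def by simp
next
  case False
  then show ?thesis
    using assms unfolding mzm_word_def by (simp only: if_False simp_thms)
qed

function mzm_parse :: "'a list \<Rightarrow> 'a list \<Rightarrow> 'a list list" where
  "mzm_parse xs [] = []"
| "mzm_parse xs (y # ys) =
    mzm_word xs (y # ys) # mzm_parse xs (drop (length (mzm_word xs (y # ys))) (y # ys))"
  by pat_completeness auto
termination
  by (relation "Wellfounded.measure (\<lambda>(xs, ys). length ys)")
     (simp_all add: mzm_word_nonempty)

definition mzm_count :: "nat \<Rightarrow> 'a stream \<Rightarrow> 'a stream \<Rightarrow> nat" where
  "mzm_count N y x = length (mzm_parse (stake N x) (stake N y))"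

definition mzm_estimator :: "nat \<Rightarrow> 'a stream \<Rightarrow> 'a stream \<Rightarrow> ereal" where
  "mzm_estimator N y x =
    (if mzm_count N y x = N then \<infinity>
     else ereal (real (mzm_count N y x) * ln (real N) / (real N - real (mzm_count N y x))))"

end

theory Submission
  imports Defs "HOL-Real_Asymp.Real_Asymp"
begin

text \<open>
  Put h = q'(0). Jensen's inequality applied to the n-th pressure, together with differentiability
  at 0, identifies h with the cross entropy, and nondegeneracy makes it positive; Chernoff's bound
  gives Q-exponentially few words of length n whose P-probability is outside
  exp (- (h + \<epsilon>) n) .. exp (- (h - \<epsilon>) n). Since P is selectively lower decoupled, almost surely
  every word of length about ln N / (h + \<epsilon>) and probability at least N powr (\<epsilon>' - 1) occurs in the
  first N letters of x, so all but o(N / ln N) parsed words are longer than that. Conversely, a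
  typical word of length about ln N / (h - \<epsilon>) has probability at most N powr (- 1 - \<epsilon>'), so by a
  first moment bound only o(N / ln N) positions of y start such a word occurring in x, while
  nondegeneracy bounds all match lengths by C ln N. Hence the number of parsed words is asymptotic
  to h N / ln N. Almost sure statements come from Borel--Cantelli along the dyadic blocks
  2 ^ k \<le> N < 2 ^ (k + 1), with at most 2 ^ k / k ^ 2 exceptional positions per block.
\<close>

subsection \<open>Combinatorics of the parsing\<close>

lemma finite_words [simp]: "finite {a :: 'a::finite list. length a = n \<and> R a}"
  by (rule finite_subset[OF _ finite_lists_length_eq[of UNIV n]]) auto

lemma finite_words' [simp]: "finite {a :: 'a::finite list. length a = n}"
  using finite_words[of n "\<lambda>_. True"] by simp

text \<open>Occurrence as a window condition on the stream: it makes occurrence monotone in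
  \<open>n\<close> and turns it into a union over positions \<open>i\<close>.\<close>

lemma sublist_stake_iff:
  "sublist b (stake n x) \<longleftrightarrow> (\<exists>i. i + length b \<le> n \<and> stake (length b) (sdrop i x) = b)"
proof
  assume "sublist b (stake n x)"
  then obtain ps ss where eq: "stake n x = ps @ b @ ss" by (auto simp: sublist_def)
  have len: "length ps + length b + length ss = n"
    using arg_cong[OF eq, of length] by simp
  have "b = take (length b) (drop (length ps) (stake n x))"
    by (simp add: eq)
  also have "\<dots> = stake (length b) (sdrop (length ps) x)"
    by (simp add: drop_stake take_stake min_absorb1 flip: len)
  finally show "\<exists>i. i + length b \<le> n \<and> stake (length b) (sdrop i x) = b"
    using len by (intro exI[of _ "length ps"]) auto
next
  assume "\<exists>i. i + length b \<le> n \<and> stake (length b) (sdrop i x) = b"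
  then obtain i where i: "i + length b \<le> n" "stake (length b) (sdrop i x) = b" by auto
  have "b = take (length b) (drop i (stake n x))"
    using i by (simp add: drop_stake take_stake min_def)
  also have "sublist \<dots> (stake n x)"
    by (meson sublist_drop sublist_order.order_trans sublist_take)
  finally show "sublist b (stake n x)" .
qed

text \<open>Used to split a count of positions at the end of the first parsed word.\<close>

lemma card_less_add:
  "card {j. j < a + b \<and> B j} = card {j. j < a \<and> B j} + card {j. j < b \<and> B (a + j)}" for a b :: nat
proof -
  have "{j. j < a + b \<and> B j} = {j. j < a \<and> B j} \<union> (+) a ` {j. j < b \<and> B (a + j)}"
  proof (intro set_eqI iffI)
    fix j assume j: "j \<in> {j. j < a + b \<and> B j}"
    show "j \<in> {j. j < a \<and> B j} \<union> (+) a ` {j. j < b \<and> B (a + j)}"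
      using j by (cases "j < a") (auto intro!: image_eqI[of _ _ "j - a"])
  qed auto
  moreover have "card ((+) a ` {j. j < b \<and> B (a + j)}) = card {j. j < b \<and> B (a + j)}"
    by (intro card_image) auto
  moreover have "{j. j < a \<and> B j} \<inter> (+) a ` {j. j < b \<and> B (a + j)} = {}" by auto
  ultimately show ?thesis
    by (simp add: card_Un_disjoint)
qed

lemma mzm_word_prefix: "prefix (mzm_word xs ys) ys"
  by (auto simp: mzm_word_def take_is_prefix)

text \<open>Prefixes of an occurring string occur, so the least length that fails exceeds
  \<open>L\<close>. The minimum covers a last word that exhausts \<open>ys\<close>.\<close>

lemma length_mzm_word_ge:
  assumes "sublist (take L ys) xs"
  shows "min L (length ys) \<le> length (mzm_word xs ys)"
proof (cases "\<exists>k\<le>length ys. \<not> sublist (take k ys) xs")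
  case True
  let ?k = "LEAST k. \<not> sublist (take k ys) xs"
  have "\<not> sublist (take ?k ys) xs" using True by (metis (mono_tags, lifting) LeastI)
  have "L < ?k"
  proof (rule ccontr)
    assume "\<not> L < ?k"
    then have "prefix (take ?k ys) (take L ys)"
      using take_is_prefix[of ?k "take L ys"] by (simp add: min_absorb1)
    then show False
      using assms \<open>\<not> sublist (take ?k ys) xs\<close> prefix_imp_sublist sublist_order.order_trans by blast
  qed
  then show ?thesis using True by (simp add: mzm_word_def)
qed (auto simp: mzm_word_def)

lemma length_mzm_word_le:
  assumes "\<not> sublist (take L ys) xs"
  shows "length (mzm_word xs ys) \<le> L"
proof (cases "\<exists>k\<le>length ys. \<not> sublist (take k ys) xs")
  case True
  then show ?thesis
    using Least_le[of "\<lambda>k. \<not> sublist (take k ys) xs", OF assms] by (simp add: mzm_word_def)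
next
  case False
  then have "\<not> L \<le> length ys" using assms by blast
  then show ?thesis using False unfolding mzm_word_def by (simp only: if_False)
qed

lemma mzm_parse_nonempty:
  assumes "ys \<noteq> []"
  shows "mzm_parse xs ys = mzm_word xs ys # mzm_parse xs (drop (length (mzm_word xs ys)) ys)"
  using assms by (cases ys) auto

text \<open>A charging argument: each word has length at least \<open>L\<close>, or starts at a
  position whose length-\<open>L\<close> window (cut off at the end of \<open>ys\<close>) is absent
  from \<open>xs\<close>, or is the last word. The last possibility accounts for the summand
  1.\<close>

lemma length_mzm_parse_upper:
  "length (mzm_parse xs ys) * L
    \<le> length ys + L * (card {j. j < length ys \<and> \<not> sublist (take L (drop j ys)) xs} + 1)"
proof (induction "length ys" arbitrary: ys rule: less_induct)
  case less
  define bad where "bad zs = {j. j < length zs \<and> \<not> sublist (take L (drop j zs)) xs}" for zs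
  show ?case
  proof (cases "ys = []")
    case False
    define w where "w = mzm_word xs ys"
    define zs where "zs = drop (length w) ys"
    have w: "w \<noteq> []" using mzm_word_nonempty[OF False] by (simp add: w_def)
    have "prefix w ys" by (simp add: w_def mzm_word_prefix)
    then have ys: "ys = w @ zs" by (auto simp: zs_def prefix_def)
    then have len: "length ys = length w + length zs" by simp
    have parse: "mzm_parse xs ys = w # mzm_parse xs zs"
      using mzm_parse_nonempty[OF False] by (simp add: w_def zs_def)
    have "length (mzm_parse xs zs) * L \<le> length zs + L * (card (bad zs) + 1)"
      unfolding bad_def by (rule less) (use w ys in auto)
    then have IH: "length (mzm_parse xs zs) * L \<le> length zs + L * card (bad zs) + L" by simp
    have goal: "length (mzm_parse xs ys) * L = length (mzm_parse xs zs) * L + L"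
      "L * (card (bad ys) + 1) = L * card (bad ys) + L" by (simp_all add: parse)
    have card: "card (bad ys) = card {j. j < length w \<and> \<not> sublist (take L (drop j ys)) xs} + card (bad zs)"
      unfolding bad_def by (simp add: ys card_less_add)
    consider "\<not> sublist (take L ys) xs" | "sublist (take L ys) xs" "L \<le> length ys"
      | "sublist (take L ys) xs" "length ys < L" by linarith
    then show ?thesis
    proof cases
      \<comment> \<open>Position 0 is bad and lies in the first word, so this word is charged to
        it.\<close>
      case 1
      have "{0} \<subseteq> {j. j < length w \<and> \<not> sublist (take L (drop j ys)) xs}"
        using 1 w by auto
      from card_mono[OF _ this] have "card (bad ys) \<ge> Suc (card (bad zs))" using card by simp
      from mult_le_mono2[OF this, of L] have "L * card (bad zs) + L \<le> L * card (bad ys)" by simp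
      then have "length (mzm_parse xs ys) * L \<le> length ys + L * (card (bad ys) + 1)"
        using IH len unfolding goal by linarith
      then show ?thesis by (simp only: bad_def)
    next
      case 2
      then have "L \<le> length w" using length_mzm_word_ge[OF 2(1)] by (simp add: w_def)
      moreover have "L * card (bad zs) \<le> L * card (bad ys)" using card by simp
      ultimately have "length (mzm_parse xs ys) * L \<le> length ys + L * (card (bad ys) + 1)"
        using IH len unfolding goal by linarith
      then show ?thesis by (simp only: bad_def)
    next
      \<comment> \<open>The remaining text is shorter than \<open>L\<close> and occurs in
        \<open>xs\<close>: it is the last word, and is paid for by the summand 1.\<close>
      case 3
      then have "length ys \<le> length w" using length_mzm_word_ge[OF 3(1)] unfolding w_def by simp
      then have "zs = []" using len by simp
      then show ?thesis using parse by simp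
    qed
  qed simp
qed

text \<open>The word lengths add up to \<open>length ys\<close>. The assumption bounds every word by
  \<open>M\<close>, and a word longer than \<open>L\<close> must start at a position whose full
  length-\<open>L\<close> window occurs in \<open>xs\<close>; the cardinality counts these
  positions.\<close>

lemma length_mzm_parse_lower:
  assumes "\<And>j. j + M \<le> length ys \<Longrightarrow> \<not> sublist (take M (drop j ys)) xs"
  shows "length ys \<le> length (mzm_parse xs ys) * L
    + M * card {j. j < length ys \<and> j + L \<le> length ys \<and> sublist (take L (drop j ys)) xs}"
  using assms
proof (induction "length ys" arbitrary: ys rule: less_induct)
  case less
  define bad where
    "bad zs = {j. j < length zs \<and> j + L \<le> length zs \<and> sublist (take L (drop j zs)) xs}" for zs
  show ?case
  proof (cases "ys = []")
    case False
    define w where "w = mzm_word xs ys"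
    define zs where "zs = drop (length w) ys"
    have w: "w \<noteq> []" using mzm_word_nonempty[OF False] by (simp add: w_def)
    have "prefix w ys" by (simp add: w_def mzm_word_prefix)
    then have ys: "ys = w @ zs" by (auto simp: zs_def prefix_def)
    then have len: "length ys = length w + length zs" by simp
    have parse: "mzm_parse xs ys = w # mzm_parse xs zs"
      using mzm_parse_nonempty[OF False] by (simp add: w_def zs_def)
    have "\<not> sublist (take M (drop j zs)) xs" if "j + M \<le> length zs" for j
      using less.prems[of "length w + j"] that by (simp add: ys)
    then have IH: "length zs \<le> length (mzm_parse xs zs) * L + M * card (bad zs)"
      unfolding bad_def by (intro less.hyps) (use w ys in auto)
    have goal: "length (mzm_parse xs ys) * L = length (mzm_parse xs zs) * L + L"
      by (simp add: parse)
    have card: "card (bad ys) = card {j. j < length w \<and> j + L \<le> length ys \<and> sublist (take L (drop j ys)) xs}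
        + card (bad zs)"
      unfolding bad_def by (simp add: ys card_less_add add.assoc)
    have M: "length w \<le> M"
    proof (cases "M \<le> length ys")
      case True
      then show ?thesis using less.prems[of 0] length_mzm_word_le[of M ys xs] by (simp add: w_def)
    qed (use ys in auto)
    show ?thesis
    proof (cases "L \<le> length ys \<and> sublist (take L ys) xs")
      case True
      then have "{0} \<subseteq> {j. j < length w \<and> j + L \<le> length ys \<and> sublist (take L (drop j ys)) xs}"
        using w by auto
      from card_mono[OF _ this] have "card (bad ys) \<ge> Suc (card (bad zs))" using card by simp
      from mult_le_mono2[OF this, of M] have "M * card (bad zs) + M \<le> M * card (bad ys)" by simp
      then have "length ys \<le> length (mzm_parse xs ys) * L + M * card (bad ys)"
        using IH M len unfolding goal by linarith
      then show ?thesis by (simp only: bad_def)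
    next
      \<comment> \<open>Either the window is absent from \<open>xs\<close>, or fewer than
        \<open>L\<close> letters are left; the word has length at most \<open>L\<close> in both
        cases.\<close>
      case L: False
      have "length w \<le> L"
      proof (cases "L \<le> length ys")
        case True
        then show ?thesis using L length_mzm_word_le[of L ys xs] by (simp add: w_def)
      qed (use ys in auto)
      moreover have "M * card (bad zs) \<le> M * card (bad ys)" using card by simp
      ultimately have "length ys \<le> length (mzm_parse xs ys) * L + M * card (bad ys)"
        using IH M len unfolding goal by linarith
      then show ?thesis by (simp only: bad_def)
    qed
  qed simp
qed

subsection \<open>Borel--Cantelli along dyadic blocks\<close>

lemma (in prob_space) AE_eventually_not:
  assumes meas: "\<And>k. Measurable.pred M (E k)"
    and bound: "eventually (\<lambda>k. prob {x \<in> space M. E k x} \<le> f k) sequentially"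
    and sum: "summable f"
  shows "AE x in M. eventually (\<lambda>k. \<not> E k x) sequentially"
proof -
  note [measurable] = meas
  have "summable (\<lambda>k. prob {x \<in> space M. E k x})"
    by (rule summable_comparison_test_ev[OF _ sum]) (use bound in simp)
  then have "AE x in M. eventually (\<lambda>k. x \<in> space M - {x \<in> space M. E k x}) sequentially"
    by (intro borel_cantelli_AE1) (auto simp: emeasure_eq_measure)
  then show ?thesis
    by (rule AE_mp) (auto elim!: eventually_mono intro!: AE_I2)
qed

text \<open>Markov's inequality for the number of events that hold, written as a sum of indicators;
  linearity of the integral deals with dependent events.\<close>

lemma (in prob_space) prob_card_ge:
  fixes J :: "'i set"
  assumes J: "finite J" and meas: "\<And>j. j \<in> J \<Longrightarrow> Measurable.pred M (E j)"
    and bound: "\<And>j. j \<in> J \<Longrightarrow> prob {x \<in> space M. E j x} \<le> p" and t: "0 < t"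
  shows "prob {x \<in> space M. t \<le> real (card {j \<in> J. E j x})} \<le> real (card J) * p / t"
proof -
  have m: "{x \<in> space M. E j x} \<in> sets M" if "j \<in> J" for j
    using meas[OF that] by measurable
  define u where "u x = (\<Sum>j\<in>J. indicat_real {x \<in> space M. E j x} x)" for x
  have u: "u x = real (card {j \<in> J. E j x})" if "x \<in> space M" for x
    using that J by (simp add: u_def indicator_def sum.If_cases Int_def)
  have int: "integrable M u"
    unfolding u_def using m
    by (intro Bochner_Integration.integrable_sum) (simp add: integrable_indicator_iff emeasure_eq_measure)
  have "prob {x \<in> space M. t \<le> real (card {j \<in> J. E j x})} = prob {x \<in> space M. t \<le> u x}"
    by (rule arg_cong[of _ _ prob]) (auto simp: u)
  also have "\<dots> \<le> (\<integral>x. u x \<partial>M) / t"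
    by (rule integral_Markov_inequality_measure[OF int sets.empty_sets _ t])
       (auto simp: u_def intro!: AE_I2 sum_nonneg)
  also have "(\<integral>x. u x \<partial>M) = (\<Sum>j\<in>J. prob {x \<in> space M. E j x})"
    unfolding u_def using m
    by (subst Bochner_Integration.integral_sum) (auto simp: integrable_indicator_iff emeasure_eq_measure intro!: sum.cong)
  also have "\<dots> \<le> real (card J) * p"
    using sum_bounded_above[of J "\<lambda>j. prob {x \<in> space M. E j x}" p] bound by simp
  finally show ?thesis using t by (simp add: divide_right_mono)
qed

text \<open>The expected number of exceptional positions is exponentially smaller than
  \<open>2 ^ k\<close>, so Markov's inequality leaves a summable bound of order
  \<open>k^2 * exp (- \<gamma> * k)\<close>. The threshold \<open>2 ^ k / k^2\<close> is negligible
  against \<open>2 ^ k\<close> even after multiplication by a match length of order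
  \<open>k\<close>.\<close>

lemma (in prob_space) AE_few_positions:
  fixes E :: "nat \<Rightarrow> nat \<Rightarrow> 'a \<Rightarrow> bool"
  assumes meas: "\<And>k j. Measurable.pred M (E k j)"
    and bound: "eventually (\<lambda>k. \<forall>j. prob {x \<in> space M. E k j x} \<le> K * exp (- \<gamma> * real k)) sequentially"
    and \<gamma>: "\<gamma> > 0"
  shows "AE x in M. eventually (\<lambda>k. real (card {j \<in> {..<2 ^ Suc k}. E k j x}) < 2 ^ k / (real k)\<^sup>2) sequentially"
proof -
  note [measurable] = meas
  have "AE x in M. eventually (\<lambda>k. \<not> 2 ^ k / (real k)\<^sup>2 \<le> real (card {j \<in> {..<2 ^ Suc k}. E k j x})) sequentially"
  proof (rule AE_eventually_not)
    show "Measurable.pred M (\<lambda>x. 2 ^ k / (real k)\<^sup>2 \<le> real (card {j \<in> {..<2 ^ Suc k}. E k j x}))" for k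
      by measurable
    show "eventually (\<lambda>k. prob {x \<in> space M. 2 ^ k / (real k)\<^sup>2 \<le> real (card {j \<in> {..<2 ^ Suc k}. E k j x})}
        \<le> 2 * K * (real k)\<^sup>2 * exp (- \<gamma> * real k)) sequentially"
      using bound eventually_gt_at_top[of 0]
    proof eventually_elim
      case (elim k)
      have "prob {x \<in> space M. 2 ^ k / (real k)\<^sup>2 \<le> real (card {j \<in> {..<2 ^ Suc k}. E k j x})}
          \<le> real (card {..<2 ^ Suc k :: nat}) * (K * exp (- \<gamma> * real k)) / (2 ^ k / (real k)\<^sup>2)"
        using elim by (intro prob_card_ge meas) auto
      also have "\<dots> = 2 * K * (real k)\<^sup>2 * exp (- \<gamma> * real k)" by simp
      finally show ?case .
    qed
    have "(\<lambda>k. 2 * K * (real k)\<^sup>2 * exp (- \<gamma> * real k)) \<in> O(\<lambda>k. inverse (real k ^ 2))"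
      using \<gamma> by real_asymp
    then show "summable (\<lambda>k. 2 * K * (real k)\<^sup>2 * exp (- \<gamma> * real k))"
      by (rule summable_comparison_test_bigo[rotated]) (simp add: inverse_power_summable)
  qed
  then show ?thesis by (simp add: not_le)
qed

text \<open>The blocks cover all \<open>N \<ge> 1\<close>, and a large \<open>N\<close> lies in a
  block with large \<open>k\<close>.\<close>

lemma eventually_dyadic:
  assumes "eventually (\<lambda>k. \<forall>N. 2 ^ k \<le> N \<and> N < 2 ^ Suc k \<longrightarrow> \<Phi> N) sequentially"
  shows "eventually \<Phi> sequentially"
proof -
  from assms obtain K where K: "\<And>k N. \<lbrakk>K \<le> k; 2 ^ k \<le> N; N < 2 ^ Suc k\<rbrakk> \<Longrightarrow> \<Phi> N"
    by (auto simp: eventually_sequentially)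
  have "\<Phi> N" if "2 ^ K \<le> N" for N
  proof -
    have "N \<ge> 1" using that one_le_power[of "2::nat" K] by linarith
    from ex_power_ivl1[OF order_refl this] obtain k where k: "2 ^ k \<le> N" "N < 2 ^ (k + 1)" by blast
    have "(2::nat) ^ K < 2 ^ Suc k" using that k by simp
    then have "K \<le> k" using power_less_imp_less_exp[of "2::nat" K "Suc k"] by simp
    then show ?thesis using K k by simp
  qed
  then show ?thesis by (auto simp: eventually_sequentially)
qed

lemma real_div_nat_ge: "real n / real d - 1 \<le> real (n div d)"
  using real_of_int_floor_ge_diff_one[of "real n / real d"]
  unfolding floor_divide_of_nat_eq by simp

subsection \<open>Stationary measures and occurrence of words\<close>

locale stationary_measure = prob_space P for P :: "'a::finite stream measure" +
  assumes sets_eq: "sets P = sets seq_space" and invariant: "shift_invariant P"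
begin

declare sets_eq [measurable_cong]

lemma space_eq [simp]: "space P = UNIV"
  using sets_eq_imp_space_eq[OF sets_eq] by (simp add: space_stream_space)

text \<open>A finite window is a measurable map into the discrete space of words, on which every
  predicate is measurable. The events below are brought into this form.\<close>

lemma pred_word [measurable]: "Measurable.pred P (\<lambda>x. R (stake n (sdrop j x)))"
proof -
  have "(\<lambda>x. stake n (sdrop j x)) \<in> measurable P (count_space UNIV)"
    by measurable
  from measurable_compose[OF this, of R "count_space UNIV"] show ?thesis by simp
qed

lemma sets_word [measurable, simp]: "{x. R (stake n (sdrop j x))} \<in> events"
  using predE[OF pred_word[of R n j]] by simp

lemma sets_prefix [measurable, simp]: "{x. R (stake n x)} \<in> events"
  using sets_word[of R n 0] by simp

lemma pred_prefix [measurable]: "Measurable.pred P (\<lambda>x. R (stake n x))"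
  using pred_word[of R n 0] by simp

lemma distr_sdrop: "distr P P (sdrop j) = P"
proof (induction j)
  case 0
  have "sdrop 0 = (\<lambda>x::'a stream. x)" by auto
  then show ?case by (simp add: distr_id)
next
  case (Suc j)
  have stl: "distr P P stl = P"
    using invariant distr_cong[OF refl sets_eq, of P stl stl] by (simp add: shift_invariant_def)
  have comp: "sdrop (Suc j) = sdrop j \<circ> (stl :: 'a stream \<Rightarrow> _)" by (simp add: fun_eq_iff)
  have "distr P P (sdrop (Suc j)) = distr (distr P P stl) P (sdrop j)"
    unfolding comp by (subst distr_distr) auto
  also have "\<dots> = P" using Suc stl by simp
  finally show ?case .
qed

lemma prob_sdrop:
  assumes A: "{x. R x} \<in> events"
  shows "prob {x. R (sdrop j x)} = prob {x. R x}"
proof -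
  have "prob {x. R x} = measure (distr P P (sdrop j)) {x. R x}" by (simp add: distr_sdrop)
  also have "\<dots> = prob (sdrop j -` {x. R x} \<inter> space P)"
    by (rule measure_distr) (use A in auto)
  finally show ?thesis by (simp add: vimage_def)
qed

text \<open>Stationarity removes the position \<open>j\<close>; the event at position 0 is a finite
  disjoint union of cylinders.\<close>

lemma prob_word: "prob {x. R (stake n (sdrop j x))} = (\<Sum>a | length a = n \<and> R a. word_prob P a)"
proof -
  have "prob {x. R (stake n (sdrop j x))} = prob {x. R (stake n x)}"
    by (rule prob_sdrop) simp
  also have "{x. R (stake n x)} = (\<Union>a\<in>{a. length a = n \<and> R a}. cylinder a)"
    by (auto simp: cylinder_def)
  also have "prob \<dots> = (\<Sum>a | length a = n \<and> R a. prob (cylinder a))"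
  proof (rule finite_measure_finite_Union)
    show "cylinder ` {a. length a = n \<and> R a} \<subseteq> events"
      unfolding cylinder_def by auto
    show "disjoint_family_on cylinder {a. length a = n \<and> R a}"
      by (auto simp: disjoint_family_on_def cylinder_def)
  qed simp
  finally show ?thesis by (simp add: word_prob_def)
qed

lemma prob_prefix: "prob {x. R (stake n x)} = (\<Sum>a | length a = n \<and> R a. word_prob P a)"
  using prob_word[of R n 0] by simp

lemma word_prob_eq: "word_prob P a = prob {x. stake (length a) (sdrop j x) = a}"
proof -
  have "{b. length b = length a \<and> b = a} = {a}" by auto
  then show ?thesis by (subst prob_word[of "\<lambda>b. b = a"]) simp
qed

lemma word_prob_nonneg [simp]: "0 \<le> word_prob P a"
  by (simp add: word_prob_def)

lemma sum_word_prob: "(\<Sum>a | length a = n. word_prob P a) = 1"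
  using prob_prefix[of "\<lambda>_. True" n] prob_space by simp

text \<open>For each length only finitely many cylinders are null, and there are countably many
  lengths.\<close>

lemma AE_supp: "AE x in P. x \<in> supp P"
proof -
  have "AE x in P. word_prob P (stake n x) > 0" for n
  proof -
    have "prob {x. \<not> word_prob P (stake n x) > 0} = 0"
      unfolding prob_prefix[of "\<lambda>a. \<not> word_prob P a > 0"]
      by (intro sum.neutral) (auto simp: not_less antisym)
    then show ?thesis
      by (subst AE_iff_measurable[OF _ refl]) (auto simp: emeasure_eq_measure sets_prefix[of "\<lambda>a. \<not> word_prob P a > 0"])
  qed
  then show ?thesis by (simp add: supp_def AE_all_countable)
qed

text \<open>A cylinder of positive probability cannot lie in the null complement of the support.
  This carries inclusions of supports over from sequences to words.\<close>

lemma supp_prefix: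
  assumes "word_prob P a > 0"
  obtains x where "x \<in> supp P" "stake (length a) x = a"
proof -
  have "\<exists>x. x \<in> supp P \<and> stake (length a) x = a"
  proof (rule ccontr)
    assume "\<not> ?thesis"
    then have "AE x in P. stake (length a) x \<noteq> a"
      using AE_supp by (auto elim!: AE_mp)
    then have "prob {x \<in> space P. stake (length a) x = a} = 0"
      by (subst prob_eq_0) (auto simp: sets_prefix[of "\<lambda>b. b = a"])
    then show False using assms by (simp add: word_prob_def cylinder_def)
  qed
  then show thesis using that by blast
qed

text \<open>Distinct words of equal length have disjoint cylinders. The lemma bounds the number of
  words in a later union bound.\<close>

lemma prob_card_words_ge:
  assumes "\<And>a. \<lbrakk>length a = n; R a\<rbrakk> \<Longrightarrow> t \<le> word_prob P a"
  shows "real (card {a. length a = n \<and> R a}) * t \<le> 1"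
proof -
  have "real (card {a. length a = n \<and> R a}) * t = (\<Sum>a | length a = n \<and> R a. t)" by simp
  also have "\<dots> \<le> (\<Sum>a | length a = n \<and> R a. word_prob P a)"
    using assms by (intro sum_mono) auto
  also have "\<dots> \<le> 1" unfolding prob_prefix[symmetric] by simp
  finally show ?thesis .
qed

text \<open>
  The lower decoupling constant depends only on the length of the first word, so the decoupled
  word b is prepended block by block to an ever longer future.
\<close>

lemma prob_word_absent:
  fixes b :: "'a list"
  assumes decoupled: "\<And>u. \<lbrakk>u \<noteq> []; word_prob P u > 0\<rbrakk> \<Longrightarrow>
      \<exists>\<xi>. length \<xi> \<le> \<tau> \<and> \<delta> * word_prob P u \<le> word_prob P (b @ \<xi> @ u)"
    and \<delta>: "0 \<le> \<delta>" "\<delta> \<le> 1" and B: "0 < length b + \<tau>"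
  shows "prob {x. \<not> sublist b (stake (Suc m * (length b + \<tau>)) x)} \<le> (1 - \<delta>) ^ m"
proof (induction m)
  case (Suc m)
  define B where "B = length b + \<tau>"
  define n where "n = Suc m * B"
  define F where "F = {u. length u = n \<and> \<not> sublist b u}"
  define E where "E u = {x. stake n (sdrop B x) = u \<and> \<not> sublist b (stake (Suc (Suc m) * B) x)}" for u
  \<comment> \<open>There are \<open>Suc m\<close> blocks for \<open>m\<close> factors: the
    additional block keeps the future \<open>u\<close> nonempty, as \<open>decoupled\<close>
    demands.\<close>
  have "n > 0" using B by (simp add: n_def B_def)
  have n: "Suc (Suc m) * B = B + n" by (simp add: n_def)
  have E_sets: "E u \<in> events" for u
    using sets.Int[OF sets_word[of "\<lambda>a. a = u" n B] sets_prefix[of "\<lambda>a. \<not> sublist b a" "Suc (Suc m) * B"]]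
    unfolding E_def by (simp add: Int_def)
  have E: "prob (E u) \<le> (1 - \<delta>) * word_prob P u" if u: "u \<in> F" for u
  proof (cases "word_prob P u > 0")
    case True
    have "u \<noteq> []" using u \<open>n > 0\<close> by (auto simp: F_def)
    from decoupled[OF this True] obtain \<xi> where
      \<xi>: "length \<xi> \<le> \<tau>" "\<delta> * word_prob P u \<le> word_prob P (b @ \<xi> @ u)" by blast
    define w where "w = b @ \<xi> @ u"
    \<comment> \<open>The gap \<open>\<xi>\<close> has variable length. Starting \<open>b\<close> at
      offset \<open>d\<close> makes \<open>u\<close> begin exactly at position \<open>B\<close>,
      whatever that length is.\<close>
    define d where "d = \<tau> - length \<xi>"
    have len_u: "length u = n" using u by (simp add: F_def)
    have d: "d + length b + length \<xi> = B" using \<xi>(1) by (simp add: d_def B_def)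
    let ?U = "{x. stake (length u) (sdrop B x) = u}" and ?W = "{x. stake (length w) (sdrop d x) = w}"
    have split: "stake (length w) (sdrop d x) = stake (length b) (sdrop d x) @
        stake (length \<xi>) (sdrop (d + length b) x) @ stake n (sdrop B x)" for x
      by (simp add: w_def len_u add.assoc flip: d stake_add)
    have W: "?W = {x. stake (length b) (sdrop d x) = b \<and> stake (length \<xi>) (sdrop (d + length b) x) = \<xi>
        \<and> stake n (sdrop B x) = u}"
      unfolding split by (auto simp: w_def)
    have "E u \<subseteq> ?U - ?W"
    proof
      fix x assume x: "x \<in> E u"
      \<comment> \<open>Seeing \<open>w\<close> at offset \<open>d\<close> would place a copy of
        \<open>b\<close> inside the first block.\<close>
      have "x \<notin> ?W"
      proof
        assume "x \<in> ?W"
        then have "stake (length b) (sdrop d x) = b" unfolding W by simp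
        then have "sublist b (stake (B + n) x)"
          unfolding sublist_stake_iff using d by (intro exI[of _ d]) auto
        then show False using x unfolding E_def n by simp
      qed
      then show "x \<in> ?U - ?W" using x by (simp add: E_def len_u)
    qed
    moreover have U_sets: "?U \<in> events" and W_sets: "?W \<in> events" by auto
    ultimately have "prob (E u) \<le> prob (?U - ?W)" by (intro finite_measure_mono) auto
    also have "\<dots> = prob ?U - prob ?W"
      using U_sets W_sets unfolding W len_u by (intro finite_measure_Diff) auto
    also have "\<dots> = word_prob P u - word_prob P w"
      using word_prob_eq[of u B] word_prob_eq[of w d] by simp
    also have "\<dots> \<le> (1 - \<delta>) * word_prob P u"
      using \<xi>(2) by (simp add: w_def algebra_simps)
    finally show ?thesis .
  next
    case False
    then have 0: "word_prob P u = 0" using word_prob_nonneg[of u] by linarith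
    have "prob (E u) \<le> prob {x. stake (length u) (sdrop B x) = u}"
      using u by (intro finite_measure_mono) (auto simp: E_def F_def)
    then show ?thesis using 0 word_prob_eq[of u B] by simp
  qed
  \<comment> \<open>If \<open>b\<close> is absent from the whole stretch, it is absent from its last
    \<open>n\<close> letters, which therefore form some \<open>u\<close> in
    \<open>F\<close>.\<close>
  have "{x. \<not> sublist b (stake (Suc (Suc m) * B) x)} \<subseteq> (\<Union>u\<in>F. E u)"
  proof
    fix x assume x: "x \<in> {x. \<not> sublist b (stake (Suc (Suc m) * B) x)}"
    have "stake (B + n) x = stake B x @ stake n (sdrop B x)" by simp
    then have "sublist (stake n (sdrop B x)) (stake (Suc (Suc m) * B) x)"
      unfolding n by (metis sublist_append_leftI)
    then have "\<not> sublist b (stake n (sdrop B x))"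
      using x sublist_order.order_trans by blast
    then show "x \<in> (\<Union>u\<in>F. E u)" using x by (auto simp: E_def F_def)
  qed
  then have "prob {x. \<not> sublist b (stake (Suc (Suc m) * B) x)} \<le> prob (\<Union>u\<in>F. E u)"
    using E_sets by (intro finite_measure_mono) (auto simp: F_def)
  also have "\<dots> \<le> (\<Sum>u\<in>F. prob (E u))"
    using E_sets by (intro finite_measure_subadditive_finite) (auto simp: F_def)
  also have "\<dots> \<le> (\<Sum>u\<in>F. (1 - \<delta>) * word_prob P u)" by (intro sum_mono E)
  also have "\<dots> = (1 - \<delta>) * prob {x. \<not> sublist b (stake n x)}"
    unfolding F_def by (subst prob_prefix[of "\<lambda>a. \<not> sublist b a"]) (simp add: sum_distrib_left)
  also have "\<dots> \<le> (1 - \<delta>) * (1 - \<delta>) ^ m"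
    using Suc \<delta> by (intro mult_left_mono) (auto simp: n_def B_def)
  finally show ?case by (simp add: B_def)
qed simp

end

section \<open>Almost sure occurrence of all frequent words\<close>

context stationary_measure
begin

text \<open>A word of length about \<open>k * ln 2 / s\<close> and probability at least
  \<open>exp (- r * L k)\<close> gets, in each of roughly \<open>2 ^ k / k\<close> blocks, a
  conditional chance of at least about \<open>2 powr (- k * r' / s)\<close>, where
  \<open>r < r' < s\<close>. Its absence is thus doubly exponentially unlikely, which beats a union
  over at most \<open>2 ^ k\<close> such words.\<close>

lemma AE_frequent_words_occur:
  assumes sld: "selectively_lower_decoupled P" and r: "0 < r" "r < s"
  shows "AE x in P. eventually (\<lambda>k. \<forall>a. length a = nat \<lfloor>real k * ln 2 / s\<rfloor> \<longrightarrow>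
    exp (- r * real (length a)) \<le> word_prob P a \<longrightarrow> sublist a (stake (2 ^ k) x)) sequentially"
proof -
  define L where "L k = nat \<lfloor>real k * ln 2 / s\<rfloor>" for k
  define absent where "absent k x \<longleftrightarrow> (\<exists>a. length a = L k \<and>
    exp (- r * real (L k)) \<le> word_prob P a \<and> \<not> sublist a (stake (2 ^ k) x))" for k x
  from sld obtain g :: "nat \<Rightarrow> real" and \<tau> where g: "g \<in> o(\<lambda>n. real n)" and
    dec: "\<And>n m a b. \<lbrakk>n \<ge> 1; m \<ge> 1; a \<in> supp_words P n; b \<in> supp_words P m\<rbrakk> \<Longrightarrow>
      \<exists>l\<le>\<tau>. \<exists>\<xi>\<in>supp_words P l. word_prob P (a @ \<xi> @ b) \<ge> exp (- g n) * word_prob P a * word_prob P b"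
    unfolding selectively_lower_decoupled_def by metis
  \<comment> \<open>The gap \<open>r' - r\<close> absorbs the sublinear decoupling constant
    \<open>g\<close>, while \<open>r' < s\<close> makes the exponent \<open>\<rho>\<close>
    positive.\<close>
  define r' where "r' = (r + s) / 2"
  have r': "r < r'" "r' < s" "0 < s" using r by (auto simp: r'_def)
  define \<rho> where "\<rho> = (1 - r' / s) * ln 2"
  have \<rho>: "\<rho> > 0" using r' by (simp add: \<rho>_def)
  have L_le: "real (L k) \<le> real k * ln 2 / s" for k
    using r' by (simp add: L_def)
  have L_top: "filterlim L at_top sequentially"
  proof -
    have "filterlim (\<lambda>k. real k * ln 2 / s) at_top sequentially" using r' by real_asymp
    then show ?thesis
      unfolding L_def using filterlim_compose[OF filterlim_nat_sequentially]
        filterlim_compose[OF filterlim_floor_sequentially] by auto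
  qed
  \<comment> \<open>Number of words times probability of absence: \<open>exp (k * ln 2)\<close>
    bounds the former, and the rest is an upper bound for \<open>exp (- \<delta> * m)\<close>. The 2
    comes from rounding the number of blocks.\<close>
  define f where "f k = exp (real k * ln 2 + 2 - exp (\<rho> * real k) / (real k * ln 2 / s + real \<tau>))" for k
  have bound: "eventually (\<lambda>k. prob {x \<in> space P. absent k x} \<le> f k) sequentially"
  proof -
    have "eventually (\<lambda>n. norm (g n) \<le> (r' - r) * norm (real n)) sequentially"
      using landau_o.smallD[OF g, of "r' - r"] r' by simp
    then have g_L: "eventually (\<lambda>k. norm (g (L k)) \<le> (r' - r) * norm (real (L k))) sequentially"
      using L_top by (rule eventually_compose_filterlim)
    have L_pos: "eventually (\<lambda>k. 1 \<le> L k) sequentially"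
      using L_top by (simp add: filterlim_at_top)
    have L_small: "eventually (\<lambda>k. real k * ln 2 / s + real \<tau> \<le> 2 ^ k) sequentially"
      using r' by real_asymp
    show ?thesis
      using g_L L_pos L_small
    proof eventually_elim
      case (elim k)
      define B where "B = L k + \<tau>"
      define \<delta> where "\<delta> = exp (- r' * real (L k))"
      define A where "A = {a :: 'a list. length a = L k \<and> exp (- r * real (L k)) \<le> word_prob P a}"
      have B: "B > 0" "B \<le> 2 ^ k"
      proof -
        have "real B \<le> 2 ^ k" using elim(3) L_le[of k] by (simp add: B_def)
        then show "B \<le> 2 ^ k" by (metis of_nat_le_iff of_nat_numeral of_nat_power)
      qed (use elim in \<open>simp add: B_def\<close>)
      \<comment> \<open>One block is subtracted so that the \<open>Suc m\<close> blocks fit into the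
        first \<open>2 ^ k\<close> letters.\<close>
      define m where "m = 2 ^ k div B - 1"
      have "2 ^ k div B \<ge> 1" using B by (simp add: Suc_leI div_greater_zero_iff)
      then have m: "Suc m = 2 ^ k div B" by (simp add: m_def)
      have m_ge: "real m \<ge> 2 ^ k / real B - 2"
        using real_div_nat_ge[of "2 ^ k" B] m[symmetric] by simp
      have \<delta>: "0 \<le> \<delta>" "\<delta> \<le> 1" using r r' by (auto simp: \<delta>_def)
      have absent: "prob {x. \<not> sublist a (stake (2 ^ k) x)} \<le> exp (2 - exp (\<rho> * real k) / (real k * ln 2 / s + real \<tau>))"
        if a: "a \<in> A" for a
      proof -
        have a: "length a = L k" "exp (- r * real (L k)) \<le> word_prob P a"
          using a by (auto simp: A_def)
        have \<delta>_le: "\<delta> \<le> exp (- g (L k)) * word_prob P a"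
        proof -
          have "g (L k) \<le> (r' - r) * real (L k)" using elim(1) by simp
          then have "\<delta> \<le> exp (- g (L k)) * exp (- r * real (L k))"
            by (simp add: \<delta>_def algebra_simps flip: exp_add)
          also have "\<dots> \<le> exp (- g (L k)) * word_prob P a"
            using a by (intro mult_left_mono) auto
          finally show ?thesis .
        qed
        have "a \<in> supp_words P (L k)"
          using a less_le_trans[OF exp_gt_zero a(2)] by (simp add: supp_words_def)
        have "\<exists>\<xi>. length \<xi> \<le> \<tau> \<and> \<delta> * word_prob P u \<le> word_prob P (a @ \<xi> @ u)"
          if u: "u \<noteq> []" "word_prob P u > 0" for u
        proof -
          have "u \<in> supp_words P (length u)" using u by (simp add: supp_words_def)
          from dec[OF elim(2) _ \<open>a \<in> supp_words P (L k)\<close> this] u(1)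
          obtain l \<xi> where \<xi>: "l \<le> \<tau>" "\<xi> \<in> supp_words P l"
            "exp (- g (L k)) * word_prob P a * word_prob P u \<le> word_prob P (a @ \<xi> @ u)"
            by (auto simp: Suc_le_eq)
          have "\<delta> * word_prob P u \<le> exp (- g (L k)) * word_prob P a * word_prob P u"
            using \<delta>_le by (intro mult_right_mono) auto
          then show ?thesis using \<xi> by (intro exI[of _ \<xi>]) (auto simp: supp_words_def)
        qed
        from prob_word_absent[OF this \<delta>, of m] B
        have "prob {x. \<not> sublist a (stake (Suc m * B) x)} \<le> (1 - \<delta>) ^ m"
          by (simp add: a B_def)
        moreover have "prob {x. \<not> sublist a (stake (2 ^ k) x)} \<le> prob {x. \<not> sublist a (stake (Suc m * B) x)}"
        proof (rule finite_measure_mono)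
          have "Suc m * B \<le> 2 ^ k" unfolding m by simp
          then show "{x. \<not> sublist a (stake (2 ^ k) x)} \<subseteq> {x. \<not> sublist a (stake (Suc m * B) x)}"
            unfolding sublist_stake_iff by (auto intro: order_trans)
        qed (rule sets_prefix)
        moreover have "(1 - \<delta>) ^ m \<le> exp (- \<delta>) ^ m"
          using \<delta> exp_ge_add_one_self[of "- \<delta>"] by (intro power_mono) auto
        moreover have "exp (- \<delta>) ^ m = exp (- (\<delta> * real m))"
          by (simp add: exp_of_nat_mult[symmetric] mult.commute)
        moreover have "exp (- (\<delta> * real m))
            \<le> exp (2 - exp (\<rho> * real k) / (real k * ln 2 / s + real \<tau>))"
          if "\<delta> * real m \<ge> exp (\<rho> * real k) / (real k * ln 2 / s + real \<tau>) - 2"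
          using that by simp
        moreover have "\<delta> * real m \<ge> exp (\<rho> * real k) / (real k * ln 2 / s + real \<tau>) - 2"
        proof -
          have B_le: "real B \<le> real k * ln 2 / s + real \<tau>" using L_le[of k] by (simp add: B_def)
          have "r' * real (L k) \<le> r' * (real k * ln 2 / s)"
            using r r' L_le[of k] by (intro mult_left_mono) auto
          then have "- (r' / s * real k * ln 2) \<le> - r' * real (L k)" by (simp add: algebra_simps)
          then have \<delta>_ge: "exp (- (r' / s * real k * ln 2)) \<le> \<delta>" by (simp add: \<delta>_def)
          have "exp (\<rho> * real k) = exp (- (r' / s * real k * ln 2)) * exp (real k * ln 2)"
            by (simp add: \<rho>_def algebra_simps flip: exp_add)
          also have "exp (real k * ln 2) = (2::real) ^ k" by (simp add: exp_of_nat_mult)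
          finally have "exp (\<rho> * real k) \<le> \<delta> * 2 ^ k"
            using \<delta>_ge by simp
          then have "exp (\<rho> * real k) / (real k * ln 2 / s + real \<tau>) \<le> \<delta> * 2 ^ k / real B"
            using B B_le \<delta>(1) by (intro frac_le) auto
          also have "\<dots> \<le> \<delta> * real m + 2 * \<delta>"
            using mult_left_mono[OF m_ge \<delta>(1)] by (simp add: algebra_simps)
          finally show ?thesis using \<delta> by linarith
        qed
        ultimately show ?thesis by linarith
      qed
      have card_A: "real (card A) \<le> exp (real k * ln 2)"
      proof -
        have "r * real (L k) \<le> s * real (L k)" using r by (intro mult_right_mono) auto
        also have "\<dots> \<le> real k * ln 2" using L_le[of k] r' by (simp add: field_simps)
        finally have "exp (r * real (L k)) \<le> exp (real k * ln 2)" by simp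
        moreover have "real (card A) * exp (- r * real (L k)) \<le> 1"
          unfolding A_def by (rule prob_card_words_ge) auto
        then have "real (card A) \<le> exp (r * real (L k))" by (simp add: exp_minus field_simps)
        ultimately show ?thesis by linarith
      qed
      have "prob {x \<in> space P. absent k x} = prob (\<Union>a\<in>A. {x. \<not> sublist a (stake (2 ^ k) x)})"
        by (rule arg_cong[of _ _ prob]) (auto simp: absent_def A_def)
      also have "\<dots> \<le> (\<Sum>a\<in>A. prob {x. \<not> sublist a (stake (2 ^ k) x)})"
        by (intro finite_measure_subadditive_finite)
           (auto simp: A_def sets_prefix[of "\<lambda>x. \<not> sublist _ x"])
      also have "\<dots> \<le> real (card A) * exp (2 - exp (\<rho> * real k) / (real k * ln 2 / s + real \<tau>))"
        by (intro sum_bounded_above absent) simp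
      also have "\<dots> \<le> exp (real k * ln 2) * exp (2 - exp (\<rho> * real k) / (real k * ln 2 / s + real \<tau>))"
        using card_A by (intro mult_right_mono) auto
      also have "\<dots> = f k" by (simp add: f_def algebra_simps flip: exp_add)
      finally show ?case .
    qed
  qed
  have "f \<in> O(\<lambda>k. inverse (real k ^ 2))"
    unfolding f_def using \<rho> r' by real_asymp
  then have "summable f"
    by (rule summable_comparison_test_bigo[rotated]) (simp add: inverse_power_summable)
  have "AE x in P. eventually (\<lambda>k. \<not> absent k x) sequentially"
  proof (rule AE_eventually_not[OF _ bound \<open>summable f\<close>])
    show "Measurable.pred P (absent k)" for k
      using pred_prefix[of "\<lambda>w. \<exists>a. length a = L k \<and> exp (- r * real (L k)) \<le> word_prob P a \<and> \<not> sublist a w" "2 ^ k"]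
      unfolding absent_def .
  qed
  then show ?thesis
    unfolding absent_def L_def by (rule AE_mp) (auto elim!: eventually_mono intro!: AE_I2)
qed

end

subsection \<open>Pressure, cross entropy and large deviations\<close>

locale dominated_pair = P: stationary_measure P + Q: stationary_measure Q
  for P Q :: "'a::finite stream measure" +
  assumes supp_subset: "supp Q \<subseteq> supp P"
begin

text \<open>The exponential moment of \<open>- ln P\<close> under \<open>Q\<close>, the argument of
  the logarithm in the pressure. It may run over all words of length \<open>n\<close>, because
  \<open>P\<close>-probability 0 forces \<open>Q\<close>-probability 0.\<close>

definition moment :: "nat \<Rightarrow> real \<Rightarrow> real" where
  "moment n \<alpha> = (\<Sum>a | length a = n. word_prob P a powr (- \<alpha>) * word_prob Q a)"

text \<open>The real-valued cross entropy of the words of length \<open>n\<close>. The HOL value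
  \<open>ln 0 = 0\<close> does no harm, since it is multiplied by a \<open>Q\<close>-probability
  equal to 0.\<close>

definition entropy_n :: "nat \<Rightarrow> real" where
  "entropy_n n = (\<Sum>a | length a = n. word_prob Q a * (- ln (word_prob P a)))"

text \<open>Absolute continuity at the level of words: a word of positive
  \<open>Q\<close>-probability extends to a point of \<open>supp Q\<close>, which lies in
  \<open>supp P\<close>.\<close>

lemma word_prob_pos: "word_prob Q a > 0 \<Longrightarrow> word_prob P a > 0"
proof -
  assume "word_prob Q a > 0"
  then obtain x where x: "x \<in> supp Q" "stake (length a) x = a" by (rule Q.supp_prefix)
  then have "x \<in> supp P" using supp_subset by blast
  then have "word_prob P (stake (length a) x) > 0" by (simp only: supp_def mem_Collect_eq)
  then show ?thesis using x by simp
qed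

lemma word_prob_eq_0: "word_prob P a = 0 \<Longrightarrow> word_prob Q a = 0"
  using word_prob_pos[of a] Q.word_prob_nonneg[of a] by linarith

lemma supp_moment:
  "(\<Sum>a\<in>supp_words P n. word_prob P a powr (- \<alpha>) * word_prob Q a) = moment n \<alpha>"
  unfolding moment_def
proof (rule sum.mono_neutral_left)
  show "\<forall>a\<in>{a. length a = n} - supp_words P n. word_prob P a powr (- \<alpha>) * word_prob Q a = 0"
    by (auto simp: supp_words_def intro!: word_prob_eq_0 antisym)
qed (auto simp: supp_words_def)

text \<open>Jensen's inequality for the exponential of \<open>- \<alpha> * ln P\<close> under
  \<open>Q\<close>, proved by summing the tangent line bound for \<open>exp\<close> at the mean
  \<open>m\<close>.\<close>

lemma moment_ge: "exp (\<alpha> * entropy_n n) \<le> moment n \<alpha>"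
proof -
  define m where "m = \<alpha> * entropy_n n"
  have m: "m = (\<Sum>a | length a = n. word_prob Q a * (- \<alpha> * ln (word_prob P a)))"
    by (simp add: m_def entropy_n_def sum_distrib_left algebra_simps)
  \<comment> \<open>The \<open>Q\<close>-probabilities add up to 1, so the bracket is
    \<open>(1 - m) + m\<close>.\<close>
  have "exp m = exp m * ((\<Sum>a | length a = n. word_prob Q a) * (1 - m)
      + (\<Sum>a | length a = n. word_prob Q a * (- \<alpha> * ln (word_prob P a))))"
    by (simp only: Q.sum_word_prob m[symmetric]) simp
  also have "\<dots> = (\<Sum>a | length a = n. exp m * (1 + (- \<alpha> * ln (word_prob P a) - m)) * word_prob Q a)"
    unfolding sum_distrib_right sum.distrib[symmetric] sum_distrib_left
    by (intro sum.cong refl) (simp add: algebra_simps)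
  also have "\<dots> \<le> (\<Sum>a | length a = n. word_prob P a powr (- \<alpha>) * word_prob Q a)"
  proof (rule sum_mono)
    fix a :: "'a list"
    show "exp m * (1 + (- \<alpha> * ln (word_prob P a) - m)) * word_prob Q a
        \<le> word_prob P a powr (- \<alpha>) * word_prob Q a"
    proof (cases "word_prob P a = 0")
      case False
      have "exp m * (1 + (- \<alpha> * ln (word_prob P a) - m))
          \<le> exp m * exp (- \<alpha> * ln (word_prob P a) - m)"
        by (intro mult_left_mono exp_ge_add_one_self) auto
      also have "\<dots> = word_prob P a powr (- \<alpha>)"
        using False by (simp add: powr_def flip: exp_add)
      finally show ?thesis by (rule mult_right_mono) simp
    qed (simp add: word_prob_eq_0)
  qed
  finally show ?thesis by (simp add: m_def moment_def)
qed

lemma moment_pos: "0 < moment n \<alpha>"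
  using moment_ge[of \<alpha> n] exp_gt_zero less_le_trans by blast

lemma ln_moment_ge: "\<alpha> * entropy_n n \<le> ln (moment n \<alpha>)"
  using moment_ge[of \<alpha> n] moment_pos[of n \<alpha>] by (simp add: ln_ge_iff)

text \<open>In HOL \<open>0 powr 0\<close> is 0, so words of \<open>P\<close>-probability 0 drop out
  of the sum; their \<open>Q\<close>-probability is 0 as well.\<close>

lemma moment_0: "moment n 0 = 1"
proof -
  have "moment n 0 = (\<Sum>a | length a = n. word_prob Q a)"
    unfolding moment_def by (intro sum.cong) (auto simp: word_prob_eq_0)
  then show ?thesis by (simp add: Q.sum_word_prob)
qed

lemma moment_minus_1: "moment n (-1) = (\<Sum>a | length a = n. word_prob P a * word_prob Q a)"
  unfolding moment_def by (intro sum.cong) auto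

lemma pressure_n_eq: "pressure_n P Q n \<alpha> = ereal (ln (moment n \<alpha>))"
  using moment_pos[of n \<alpha>] by (simp add: pressure_n_def supp_moment eln_def)

lemma pressure_n_divide:
  "n > 0 \<Longrightarrow> pressure_n P Q n \<alpha> / ereal (real n) = ereal (ln (moment n \<alpha>) / real n)"
  by (simp add: pressure_n_eq)

lemma entropy_sum_eq:
  "(\<Sum>a | length a = n. ereal (word_prob Q a) * (- eln (word_prob P a))) = ereal (entropy_n n)"
proof -
  have "ereal (word_prob Q a) * (- eln (word_prob P a))
      = ereal (word_prob Q a * (- ln (word_prob P a)))" for a
    by (cases "word_prob P a = 0") (auto simp: eln_def word_prob_eq_0)
  then show ?thesis by (simp add: entropy_n_def)
qed

text \<open>Markov's inequality for the exponential moment. The condition on \<open>R\<close> leaves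
  the sign of \<open>\<alpha>\<close> open: positive values serve for rare words, negative ones for
  frequent words.\<close>

lemma prob_chernoff:
  assumes R: "\<And>a. \<lbrakk>length a = n; R a; word_prob P a > 0\<rbrakk>
    \<Longrightarrow> 1 \<le> word_prob P a powr (- \<alpha>) * exp (- (\<alpha> * r * real n))"
  shows "Q.prob {y. R (stake n y)} \<le> exp (ln (moment n \<alpha>) - \<alpha> * r * real n)"
proof -
  let ?e = "exp (- (\<alpha> * r * real n))"
  have "Q.prob {y. R (stake n y)} = (\<Sum>a | length a = n \<and> R a. word_prob Q a)"
    by (rule Q.prob_prefix)
  also have "\<dots> \<le> (\<Sum>a | length a = n \<and> R a. word_prob P a powr (- \<alpha>) * word_prob Q a * ?e)"
  proof (rule sum_mono)
    fix a assume a: "a \<in> {a. length a = n \<and> R a}"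
    show "word_prob Q a \<le> word_prob P a powr (- \<alpha>) * word_prob Q a * ?e"
    proof (cases "word_prob P a = 0")
      case False
      then have "word_prob P a > 0" using P.word_prob_nonneg[of a] by linarith
      then have "1 * word_prob Q a \<le> word_prob P a powr (- \<alpha>) * ?e * word_prob Q a"
        using a by (intro mult_right_mono R) auto
      then show ?thesis by (simp add: algebra_simps)
    qed (simp add: word_prob_eq_0)
  qed
  also have "\<dots> \<le> (\<Sum>a | length a = n. word_prob P a powr (- \<alpha>) * word_prob Q a * ?e)"
    by (intro sum_mono2) auto
  also have "\<dots> = moment n \<alpha> * ?e"
    by (simp add: moment_def sum_distrib_right)
  also have "\<dots> = exp (ln (moment n \<alpha>) - \<alpha> * r * real n)"
    using moment_pos[of n \<alpha>] by (simp add: exp_diff exp_minus divide_inverse)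
  finally show ?thesis .
qed

end

section \<open>Large deviation bounds and the cross entropy as a derivative\<close>

locale differentiable_pressure = dominated_pair P Q
  for P Q :: "'a::finite stream measure" +
  fixes q :: "real \<Rightarrow> real" and I :: "real set" and h :: real
  assumes nondeg: "nondegenerate P Q"
    and I: "open I" "0 \<in> I"
    and pressure: "\<And>\<alpha>. \<alpha> \<in> I \<Longrightarrow>
      (\<lambda>n. pressure_n P Q n \<alpha> / ereal (real n)) \<longlonglongrightarrow> ereal (q \<alpha>)"
    and q_deriv: "(q has_real_derivative h) (at 0)"
begin

lemma ln_moment_tendsto:
  assumes "\<alpha> \<in> I"
  shows "(\<lambda>n. ln (moment n \<alpha>) / real n) \<longlonglongrightarrow> q \<alpha>"
proof -
  have "(\<lambda>n. ereal (ln (moment n \<alpha>) / real n)) \<longlonglongrightarrow> ereal (q \<alpha>)"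
    using pressure[OF assms]
    by (rule Lim_transform_eventually[OF _ eventually_mono[OF eventually_gt_at_top[of 0]]])
       (rule pressure_n_divide)
  then show ?thesis by simp
qed

lemma q_0: "q 0 = 0"
  using ln_moment_tendsto[OF I(2)] by (simp add: moment_0 LIMSEQ_const_iff)

lemma eventually_I: "eventually (\<lambda>\<alpha>. \<alpha> \<in> I) (at 0 within S)"
  using I by (metis eventually_at_topological)

lemma q_divide_tendsto: "((\<lambda>\<alpha>. q \<alpha> / \<alpha>) \<longlongrightarrow> h) (at 0)"
  using q_deriv by (simp add: DERIV_def q_0)

text \<open>As \<open>q 0 = 0\<close>, the quotient \<open>q \<alpha> / \<alpha>\<close> tends to
  \<open>h\<close>; a small positive \<open>\<alpha>\<close> therefore gives a positive Chernoff
  exponent \<open>\<alpha> * r - q \<alpha>\<close>.\<close>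

lemma obtain_right:
  assumes "r > h"
  obtains \<alpha> where "\<alpha> \<in> I" "\<alpha> > 0" "q \<alpha> < \<alpha> * r"
proof -
  have "eventually (\<lambda>\<alpha>. q \<alpha> / \<alpha> < r) (at_right 0)"
    using order_tendstoD(2)[OF q_divide_tendsto assms] eventually_at_split by blast
  then have "eventually (\<lambda>\<alpha>. \<alpha> \<in> I \<and> \<alpha> > 0 \<and> q \<alpha> / \<alpha> < r) (at_right 0)"
    using eventually_I eventually_at_right_less[of 0] by eventually_elim auto
  then obtain \<alpha> where "\<alpha> \<in> I" "\<alpha> > 0" "q \<alpha> / \<alpha> < r"
    using eventually_happens trivial_limit_at_right_real by blast
  then show thesis by (intro that[of \<alpha>]) (auto simp: field_simps)
qed

text \<open>The same for rates below \<open>h\<close>: multiplication by a negative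
  \<open>\<alpha>\<close> turns \<open>q \<alpha> / \<alpha> > r\<close> into the same
  inequality.\<close>

lemma obtain_left:
  assumes "r < h"
  obtains \<alpha> where "\<alpha> \<in> I" "\<alpha> < 0" "q \<alpha> < \<alpha> * r"
proof -
  have "eventually (\<lambda>\<alpha>. q \<alpha> / \<alpha> > r) (at_left 0)"
    using order_tendstoD(1)[OF q_divide_tendsto assms] eventually_at_split by blast
  moreover have "eventually (\<lambda>\<alpha>::real. \<alpha> < 0) (at_left 0)"
    by (simp add: eventually_at_filter)
  ultimately have "eventually (\<lambda>\<alpha>. \<alpha> \<in> I \<and> \<alpha> < 0 \<and> q \<alpha> / \<alpha> > r) (at_left 0)"
    using eventually_I by eventually_elim auto
  then obtain \<alpha> where "\<alpha> \<in> I" "\<alpha> < 0" "q \<alpha> / \<alpha> > r"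
    using eventually_happens trivial_limit_at_left_real by blast
  then show thesis by (intro that[of \<alpha>]) (auto simp: field_simps)
qed

lemma eventually_exp_bound:
  assumes "\<alpha> \<in> I" "q \<alpha> < \<alpha> * r"
  obtains c where "c > 0"
    "eventually (\<lambda>n. exp (ln (moment n \<alpha>) - \<alpha> * r * real n) \<le> exp (- c * real n)) sequentially"
proof
  \<comment> \<open>Half of the gap is kept as the rate; the other half absorbs the error in the
    limit defining \<open>q \<alpha>\<close>.\<close>
  let ?c = "(\<alpha> * r - q \<alpha>) / 2"
  show "?c > 0" using assms by simp
  have "eventually (\<lambda>n. ln (moment n \<alpha>) / real n < \<alpha> * r - ?c) sequentially"
    using assms by (intro order_tendstoD(2)[OF ln_moment_tendsto]) (auto simp: field_simps)
  then show "eventually (\<lambda>n. exp (ln (moment n \<alpha>) - \<alpha> * r * real n) \<le> exp (- ?c * real n)) sequentially"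
    using eventually_gt_at_top[of 0]
  proof eventually_elim
    case (elim n)
    then have "ln (moment n \<alpha>) < (\<alpha> * r - ?c) * real n"
      by (simp add: pos_divide_less_eq)
    also have "\<dots> = \<alpha> * r * real n + - ?c * real n" by (simp only: algebra_simps)
    finally show ?case by simp
  qed
qed

text \<open>Chernoff's bound with \<open>\<alpha> > 0\<close>, for which
  \<open>P powr (- \<alpha>)\<close> is large on rare words.\<close>

lemma prob_rare_word:
  assumes "r > h"
  obtains c where "c > 0"
    "eventually (\<lambda>n. Q.prob {y. word_prob P (stake n y) < exp (- r * real n)} \<le> exp (- c * real n)) sequentially"
proof -
  obtain \<alpha> where \<alpha>: "\<alpha> \<in> I" "\<alpha> > 0" "q \<alpha> < \<alpha> * r" using obtain_right[OF assms] .
  obtain c where c: "c > 0"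
    "eventually (\<lambda>n. exp (ln (moment n \<alpha>) - \<alpha> * r * real n) \<le> exp (- c * real n)) sequentially"
    using eventually_exp_bound[OF \<alpha>(1,3)] .
  have "Q.prob {y. word_prob P (stake n y) < exp (- r * real n)}
      \<le> exp (ln (moment n \<alpha>) - \<alpha> * r * real n)" for n
  proof (rule prob_chernoff[where R = "\<lambda>a. word_prob P a < exp (- r * real n)"])
    fix a :: "'a list"
    assume a: "word_prob P a < exp (- r * real n)" "word_prob P a > 0"
    then have "ln (word_prob P a) < ln (exp (- r * real n))" by (subst ln_less_cancel_iff) auto
    then have "ln (word_prob P a) < - r * real n" by simp
    then have "\<alpha> * ln (word_prob P a) \<le> \<alpha> * (- r * real n)"
      using \<alpha> by (intro mult_left_mono) auto
    then show "1 \<le> word_prob P a powr (- \<alpha>) * exp (- (\<alpha> * r * real n))"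
      using a by (simp add: powr_def algebra_simps flip: exp_add)
  qed
  then show thesis
    using c(1) by (intro that[of c] eventually_mono[OF c(2)]) (auto intro: order_trans)
qed

text \<open>Chernoff's bound with \<open>\<alpha> < 0\<close>, for which
  \<open>P powr (- \<alpha>)\<close> is large on frequent words.\<close>

lemma prob_frequent_word:
  assumes "r < h"
  obtains c where "c > 0"
    "eventually (\<lambda>n. Q.prob {y. exp (- r * real n) < word_prob P (stake n y)} \<le> exp (- c * real n)) sequentially"
proof -
  obtain \<alpha> where \<alpha>: "\<alpha> \<in> I" "\<alpha> < 0" "q \<alpha> < \<alpha> * r" using obtain_left[OF assms] .
  obtain c where c: "c > 0"
    "eventually (\<lambda>n. exp (ln (moment n \<alpha>) - \<alpha> * r * real n) \<le> exp (- c * real n)) sequentially"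
    using eventually_exp_bound[OF \<alpha>(1,3)] .
  have "Q.prob {y. exp (- r * real n) < word_prob P (stake n y)}
      \<le> exp (ln (moment n \<alpha>) - \<alpha> * r * real n)" for n
  proof (rule prob_chernoff[where R = "\<lambda>a. exp (- r * real n) < word_prob P a"])
    fix a :: "'a list"
    assume a: "exp (- r * real n) < word_prob P a" "word_prob P a > 0"
    then have "ln (exp (- r * real n)) < ln (word_prob P a)" by (subst ln_less_cancel_iff) auto
    then have "- r * real n < ln (word_prob P a)" by simp
    then have "\<alpha> * ln (word_prob P a) \<le> \<alpha> * (- r * real n)"
      using \<alpha> by (intro mult_left_mono_neg) auto
    then show "1 \<le> word_prob P a powr (- \<alpha>) * exp (- (\<alpha> * r * real n))"
      using a by (simp add: powr_def algebra_simps flip: exp_add)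
  qed
  then show thesis
    using c(1) by (intro that[of c] eventually_mono[OF c(2)]) (auto intro: order_trans)
qed

text \<open>By Jensen, \<open>\<alpha> * entropy_n n / n\<close> is at most a quantity tending to
  \<open>q \<alpha>\<close>. Dividing by a small positive or negative \<open>\<alpha>\<close> gives
  an upper or a lower bound, and the two meet because \<open>q\<close> is differentiable at
  0.\<close>

lemma entropy_n_tendsto: "(\<lambda>n. entropy_n n / real n) \<longlonglongrightarrow> h"
proof (rule order_tendstoI)
  fix r assume "h < r"
  then obtain \<alpha> where \<alpha>: "\<alpha> \<in> I" "\<alpha> > 0" "q \<alpha> < \<alpha> * r" by (rule obtain_right)
  show "eventually (\<lambda>n. entropy_n n / real n < r) sequentially"
    using order_tendstoD(2)[OF ln_moment_tendsto[OF \<alpha>(1)] \<alpha>(3)] eventually_gt_at_top[of 0]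
  proof eventually_elim
    case (elim n)
    have "\<alpha> * entropy_n n / real n \<le> ln (moment n \<alpha>) / real n"
      using ln_moment_ge by (intro divide_right_mono) auto
    then have "\<alpha> * (entropy_n n / real n) < \<alpha> * r" using elim by simp
    then show ?case using \<alpha>(2) by (simp only: mult_less_cancel_left)
  qed
next
  fix r assume "r < h"
  then obtain \<alpha> where \<alpha>: "\<alpha> \<in> I" "\<alpha> < 0" "q \<alpha> < \<alpha> * r" by (rule obtain_left)
  show "eventually (\<lambda>n. r < entropy_n n / real n) sequentially"
    using order_tendstoD(2)[OF ln_moment_tendsto[OF \<alpha>(1)] \<alpha>(3)] eventually_gt_at_top[of 0]
  proof eventually_elim
    case (elim n)
    have "\<alpha> * entropy_n n / real n \<le> ln (moment n \<alpha>) / real n"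
      using ln_moment_ge by (intro divide_right_mono) auto
    then have "\<alpha> * (entropy_n n / real n) < \<alpha> * r" using elim by simp
    then show ?case using \<alpha>(2) by (simp only: mult_less_cancel_left)
  qed
qed

lemma cross_entropy_eq: "cross_entropy Q P = ereal h"
  unfolding cross_entropy_def entropy_sum_eq
proof (rule limI)
  have "(\<lambda>n. ereal (entropy_n n / real n)) \<longlonglongrightarrow> ereal h"
    using entropy_n_tendsto by simp
  then show "(\<lambda>n. ereal (entropy_n n) / ereal (real n)) \<longlonglongrightarrow> ereal h"
    by (rule Lim_transform_eventually[OF _ eventually_mono[OF eventually_gt_at_top[of 0]]]) simp
qed

text \<open>The sum is the moment at -1: the probability that independent samples from
  \<open>P\<close> and \<open>Q\<close> agree in their first \<open>n\<close> letters.\<close>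

lemma collision_bound:
  obtains c where "c > 0"
    "eventually (\<lambda>n. (\<Sum>a | length a = n. word_prob P a * word_prob Q a) \<le> exp (- c * real n)) sequentially"
proof -
  have "limsup (\<lambda>n. pressure_n P Q n (-1) / ereal (real n)) < 0"
    using nondeg by (simp add: nondegenerate_def upper_pressure_def)
  \<comment> \<open>The upper limit may be minus infinity, so a real rate is chosen strictly between
    it and 0.\<close>
  then obtain b where b: "limsup (\<lambda>n. pressure_n P Q n (-1) / ereal (real n)) < ereal b" "ereal b < 0"
    using ereal_dense2 by blast
  have "eventually (\<lambda>n. pressure_n P Q n (-1) / ereal (real n) < ereal b) sequentially"
    using b(1) by (rule Limsup_lessD)
  then have "eventually (\<lambda>n. moment n (-1) \<le> exp (- (- b) * real n)) sequentially"
    using eventually_gt_at_top[of 0]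
  proof eventually_elim
    case (elim n)
    then have "ln (moment n (-1)) < b * real n"
      by (simp add: pressure_n_divide pos_divide_less_eq)
    then have "exp (ln (moment n (-1))) < exp (b * real n)" by (simp only: exp_less_cancel_iff)
    then show ?case using moment_pos[of n "-1"] by simp
  qed
  then show thesis using b(2) by (intro that[of "- b"]) (auto simp: moment_minus_1)
qed

text \<open>Jensen at \<open>\<alpha> = -1\<close> bounds \<open>entropy_n n / n\<close> below by
  the collision rate \<open>c\<close>.\<close>

lemma h_pos: "h > 0"
proof -
  obtain c where c: "c > 0"
    "eventually (\<lambda>n. (\<Sum>a | length a = n. word_prob P a * word_prob Q a) \<le> exp (- c * real n)) sequentially"
    using collision_bound .
  have "eventually (\<lambda>n. c \<le> entropy_n n / real n) sequentially"
    using c(2) eventually_gt_at_top[of 0]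
  proof eventually_elim
    case (elim n)
    have "- entropy_n n \<le> ln (moment n (-1))" using ln_moment_ge[of "-1" n] by simp
    also have "\<dots> \<le> ln (exp (- c * real n))"
      using elim(1) moment_pos[of n "-1"] by (subst ln_le_cancel_iff) (auto simp: moment_minus_1)
    finally show ?case using elim(2) by (simp add: pos_le_divide_eq)
  qed
  then have "c \<le> h" by (intro tendsto_lowerbound[OF entropy_n_tendsto]) auto
  then show ?thesis using c(1) by linarith
qed

end

subsection \<open>Number of parsed words\<close>

context dominated_pair
begin

sublocale PQ: pair_prob_space P Q ..

sublocale PQ: prob_space "P \<Otimes>\<^sub>M Q"
  by (rule PQ.prob_space_axioms)

lemma space_pair [simp]: "space (P \<Otimes>\<^sub>M Q) = UNIV"
  by (simp add: space_pair_measure)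

lemma pred_word_pair [measurable]:
  "Measurable.pred (P \<Otimes>\<^sub>M Q) (\<lambda>z. R (stake n (sdrop i (fst z))) (stake m (sdrop j (snd z))))"
proof -
  have fst: "(\<lambda>z. stake n (sdrop i (fst z))) \<in> measurable (P \<Otimes>\<^sub>M Q) (count_space UNIV)"
    and snd: "(\<lambda>z. stake m (sdrop j (snd z))) \<in> measurable (P \<Otimes>\<^sub>M Q) (count_space UNIV)"
    by measurable
  have "(\<lambda>z. (stake n (sdrop i (fst z)), stake m (sdrop j (snd z))))
      \<in> measurable (P \<Otimes>\<^sub>M Q) (count_space UNIV \<Otimes>\<^sub>M count_space UNIV)"
    using fst snd by (rule measurable_Pair)
  then have "(\<lambda>z. (stake n (sdrop i (fst z)), stake m (sdrop j (snd z))))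
      \<in> measurable (P \<Otimes>\<^sub>M Q) (count_space UNIV)"
    by (simp add: pair_measure_countable)
  from measurable_compose[OF this, of "\<lambda>(u, v). R u v" "count_space UNIV"] show ?thesis by simp
qed

lemma sets_word_pair [simp]:
  "{z. R (stake n (sdrop i (fst z))) (stake m (sdrop j (snd z)))} \<in> sets (P \<Otimes>\<^sub>M Q)"
  using predE[OF pred_word_pair[of R n i m j]] by simp

lemma prob_common_word:
  "measure (P \<Otimes>\<^sub>M Q) {z. stake (length a) (sdrop i (fst z)) = a \<and> stake (length a) (sdrop j (snd z)) = a}
    = word_prob P a * word_prob Q a"
proof -
  let ?A = "{x. stake (length a) (sdrop i x) = a}" and ?B = "{y. stake (length a) (sdrop j y) = a}"
  have "{z. stake (length a) (sdrop i (fst z)) = a \<and> stake (length a) (sdrop j (snd z)) = a} = ?A \<times> ?B"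
    by auto
  moreover have "emeasure (P \<Otimes>\<^sub>M Q) (?A \<times> ?B) = emeasure P ?A * emeasure Q ?B"
    by (intro Q.emeasure_pair_measure_Times) simp_all
  ultimately show ?thesis
    by (simp add: measure_def enn2real_mult flip: P.word_prob_eq[of a i] Q.word_prob_eq[of a j])
       (simp add: P.word_prob_eq[of a i] Q.word_prob_eq[of a j] measure_def)
qed

text \<open>A union bound over the place of the match in the first sequence and the common word. The
  filter \<open>R\<close> serves to restrict the sum to words of small
  \<open>P\<close>-probability.\<close>

lemma prob_occurs_le:
  assumes "L > 0"
  shows "measure (P \<Otimes>\<^sub>M Q) {z. sublist (stake L (sdrop j (snd z))) (stake N (fst z)) \<and> R (stake L (sdrop j (snd z)))}
    \<le> real N * (\<Sum>a | length a = L \<and> R a. word_prob P a * word_prob Q a)"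
proof -
  let ?W = "{a :: 'a list. length a = L \<and> R a}"
  let ?C = "\<lambda>(i, a). {z. stake (length a) (sdrop i (fst z)) = a \<and> stake (length a) (sdrop j (snd z)) = a}"
  have C_sets: "?C p \<in> sets (P \<Otimes>\<^sub>M Q)" for p
    using sets_word_pair[of "\<lambda>u v. u = snd p \<and> v = snd p" "length (snd p)" "fst p" "length (snd p)" j]
    by (simp add: split_beta)
  have "{z. sublist (stake L (sdrop j (snd z))) (stake N (fst z)) \<and> R (stake L (sdrop j (snd z)))}
      \<subseteq> (\<Union>p\<in>{..<N} \<times> ?W. ?C p)"
  proof
    fix z assume z: "z \<in> {z. sublist (stake L (sdrop j (snd z))) (stake N (fst z)) \<and> R (stake L (sdrop j (snd z)))}"
    then obtain i where "i + L \<le> N" "stake L (sdrop i (fst z)) = stake L (sdrop j (snd z))"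
      unfolding sublist_stake_iff by auto
    \<comment> \<open>Since \<open>L > 0\<close>, the bound \<open>i + L \<le> N\<close> gives
      \<open>i < N\<close>.\<close>
    then show "z \<in> (\<Union>p\<in>{..<N} \<times> ?W. ?C p)"
      using z assms by (intro UN_I[of "(i, stake L (sdrop j (snd z)))"]) auto
  qed
  then have "measure (P \<Otimes>\<^sub>M Q) {z. sublist (stake L (sdrop j (snd z))) (stake N (fst z)) \<and> R (stake L (sdrop j (snd z)))}
      \<le> measure (P \<Otimes>\<^sub>M Q) (\<Union>p\<in>{..<N} \<times> ?W. ?C p)"
    using C_sets by (intro PQ.finite_measure_mono) auto
  also have "\<dots> \<le> (\<Sum>p\<in>{..<N} \<times> ?W. measure (P \<Otimes>\<^sub>M Q) (?C p))"
    using C_sets by (intro PQ.finite_measure_subadditive_finite) auto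
  also have "\<dots> = (\<Sum>p\<in>{..<N} \<times> ?W. word_prob P (snd p) * word_prob Q (snd p))"
    by (intro sum.cong) (auto simp: prob_common_word)
  also have "\<dots> = (\<Sum>i<N. \<Sum>a\<in>?W. word_prob P a * word_prob Q a)"
    by (subst sum.cartesian_product) (simp only: case_prod_beta')
  also have "\<dots> = real N * (\<Sum>a\<in>?W. word_prob P a * word_prob Q a)" by simp
  finally show ?thesis .
qed

lemma distr_snd: "distr (P \<Otimes>\<^sub>M Q) Q snd = Q"
proof (rule measure_eqI)
  fix A assume "A \<in> sets (distr (P \<Otimes>\<^sub>M Q) Q snd)"
  then have A: "A \<in> sets Q" by simp
  have "snd -` A \<inter> space (P \<Otimes>\<^sub>M Q) = UNIV \<times> A" by auto
  moreover have "emeasure (P \<Otimes>\<^sub>M Q) (UNIV \<times> A) = emeasure P UNIV * emeasure Q A"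
    using A by (intro Q.emeasure_pair_measure_Times) (use sets.top[of P] in simp_all)
  ultimately show "emeasure (distr (P \<Otimes>\<^sub>M Q) Q snd) A = emeasure Q A"
    using A P.emeasure_space_1 by (simp add: emeasure_distr)
qed simp

lemma AE_fst: "AE x in P. \<phi> x \<Longrightarrow> AE z in P \<Otimes>\<^sub>M Q. \<phi> (fst z)"
  using AE_distrD[OF measurable_fst[of P Q], of \<phi>] unfolding Q.distr_pair_fst by simp

lemma AE_snd: "AE y in Q. \<phi> y \<Longrightarrow> AE z in P \<Otimes>\<^sub>M Q. \<phi> (snd z)"
  using AE_distrD[OF measurable_snd[of P Q], of \<phi>] unfolding distr_snd by simp

end

section \<open>Almost sure asymptotics of the number of parsed words\<close>

context differentiable_pressure
begin

text \<open>Windows of \<open>y\<close> of length about \<open>k * ln 2 / s\<close> are rarely of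
  small \<open>P\<close>-probability, and all others occur in \<open>x\<close>. The parsing bound
  then gives about \<open>N / L k\<close> words, that is, about \<open>s * N / ln N\<close>.\<close>

lemma AE_count_upper:
  assumes sld: "selectively_lower_decoupled P" and t: "h < t"
  shows "AE z in P \<Otimes>\<^sub>M Q. eventually (\<lambda>N. real (mzm_count N (snd z) (fst z)) * ln (real N) / real N < t) sequentially"
proof -
  \<comment> \<open>Midpoints give \<open>h < r < s < t\<close>: \<open>r\<close> is the threshold
    for rare words, \<open>s\<close> fixes the window length, and \<open>t - s\<close> absorbs the
    error terms.\<close>
  define s where "s = (h + t) / 2"
  define r where "r = (h + s) / 2"
  have s: "h < s" "s < t" and r: "h < r" "r < s" using t by (auto simp: s_def r_def)
  have pos: "0 < r" "0 < s" using h_pos r by auto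
  define L where "L k = nat \<lfloor>real k * ln 2 / s\<rfloor>" for k
  obtain c where c: "c > 0"
    "eventually (\<lambda>n. Q.prob {y. word_prob P (stake n y) < exp (- r * real n)} \<le> exp (- c * real n)) sequentially"
    using prob_rare_word[OF r(1)] by blast
  have L_ge: "real k * ln 2 / s - 1 \<le> real (L k)" for k
    using pos by (simp add: L_def)
  have L_top: "filterlim L at_top sequentially"
  proof -
    have "filterlim (\<lambda>k. real k * ln 2 / s) at_top sequentially" using pos by real_asymp
    then show ?thesis
      unfolding L_def using filterlim_compose[OF filterlim_nat_sequentially]
        filterlim_compose[OF filterlim_floor_sequentially] by auto
  qed
  define rare where "rare k j y \<longleftrightarrow> word_prob P (stake (L k) (sdrop j y)) < exp (- r * real (L k))" for k j y
  have few: "AE y in Q. eventually (\<lambda>k. real (card {j \<in> {..<2 ^ Suc k}. rare k j y}) < 2 ^ k / (real k)\<^sup>2) sequentially"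
  proof (rule Q.AE_few_positions)
    show "Measurable.pred Q (rare k j)" for k j
      unfolding rare_def by (rule Q.pred_word)
    show "0 < c * ln 2 / s" using c pos by simp
    show "eventually (\<lambda>k. \<forall>j. Q.prob {y \<in> space Q. rare k j y} \<le> exp c * exp (- (c * ln 2 / s) * real k)) sequentially"
      using eventually_compose_filterlim[OF c(2) L_top]
    proof eventually_elim
      case (elim k)
      show ?case
      proof
        fix j
        have "Q.prob {y \<in> space Q. rare k j y} = Q.prob {y. word_prob P (stake (L k) y) < exp (- r * real (L k))}"
          unfolding rare_def using Q.prob_word[of "\<lambda>a. word_prob P a < exp (- r * real (L k))" "L k" j]
            Q.prob_prefix[of "\<lambda>a. word_prob P a < exp (- r * real (L k))" "L k"] by simp
        also have "\<dots> \<le> exp (- c * real (L k))" by (rule elim)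
        also have "\<dots> \<le> exp (c + - (c * ln 2 / s) * real k)"
          using mult_left_mono[OF L_ge[of k], of c] c(1) by (simp add: algebra_simps)
        finally show "Q.prob {y \<in> space Q. rare k j y} \<le> exp c * exp (- (c * ln 2 / s) * real k)"
          by (simp only: exp_add[symmetric])
      qed
    qed
  qed
  \<comment> \<open>An upper bound for the normalised count throughout block \<open>k\<close>: the
    three summands come from long words, bad positions and the last word, the factor in front from
    \<open>ln N\<close>.\<close>
  define g where "g k = (real k + 1) * ln 2 * (1 / (real k * ln 2 / s - 1) + 1 / (real k)\<^sup>2 + 1 / 2 ^ k)" for k
  have "g \<longlonglongrightarrow> s" unfolding g_def using pos by real_asymp
  then have g: "eventually (\<lambda>k. g k < t) sequentially" using s by (intro order_tendstoD)
  have L_pos: "eventually (\<lambda>k. real k * ln 2 / s - 1 > 0) sequentially" using pos by real_asymp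
  show ?thesis
    using AE_fst[OF P.AE_frequent_words_occur[OF sld pos(1) r(2)]] AE_snd[OF few]
  proof eventually_elim
    case (elim z)
    obtain x y where z: "z = (x, y)" by (cases z)
    show ?case
    proof (rule eventually_dyadic)
      show "eventually (\<lambda>k. \<forall>N. 2 ^ k \<le> N \<and> N < 2 ^ Suc k \<longrightarrow>
          real (mzm_count N (snd z) (fst z)) * ln (real N) / real N < t) sequentially"
        using elim g L_pos eventually_gt_at_top[of 0]
      proof eventually_elim
        case (elim k)
        show ?case
        proof (intro allI impI)
          fix N :: nat assume N: "2 ^ k \<le> N \<and> N < 2 ^ Suc k"
          have N_pos: "real N > 0" "real N \<ge> 1" "(2::real) ^ k \<le> real N"
            using N one_le_power[of "2::nat" k] by (auto simp: numeral_power_le_of_nat_cancel_iff)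
          have occurs: "sublist a (stake N x)"
            if "length a = L k" "exp (- r * real (L k)) \<le> word_prob P a" for a
          proof -
            have "sublist a (stake (2 ^ k) x)" using elim(1) that by (auto simp: z L_def)
            then show ?thesis using N unfolding sublist_stake_iff by (auto intro: order_trans)
          qed
          define bad where "bad = {j. j < length (stake N y) \<and> \<not> sublist (take (L k) (drop j (stake N y))) (stake N x)}"
          have "bad \<subseteq> {j \<in> {..<2 ^ Suc k}. rare k j y}"
          proof
            fix j assume j: "j \<in> bad"
            have not_sublist: "\<not> sublist (take (L k) (drop j (stake N y))) (stake N x)"
              using j unfolding bad_def by blast
            \<comment> \<open>Near the end of \<open>y\<close> the window is cut off; being a prefix
              of the full window, it can be absent only if the full one is.\<close>
            have "take (L k) (drop j (stake N y)) = take (N - j) (stake (L k) (sdrop j y))"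
              by (simp add: drop_stake take_stake min.commute)
            then have "prefix (take (L k) (drop j (stake N y))) (stake (L k) (sdrop j y))"
              by (simp only: take_is_prefix)
            then have "\<not> sublist (stake (L k) (sdrop j y)) (stake N x)"
              using not_sublist prefix_imp_sublist sublist_order.order_trans by blast
            then have "rare k j y"
              using occurs[of "stake (L k) (sdrop j y)"] by (auto simp: rare_def not_le)
            then show "j \<in> {j \<in> {..<2 ^ Suc k}. rare k j y}" using j N by (auto simp: bad_def)
          qed
          then have "card bad \<le> card {j \<in> {..<2 ^ Suc k}. rare k j y}" by (intro card_mono) auto
          then have bad: "real (card bad) \<le> 2 ^ k / (real k)\<^sup>2" using elim(2) by (simp add: z)
          define C where "C = real (mzm_count N y x)"
          have "mzm_count N y x * L k \<le> N + L k * (card bad + 1)"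
            using length_mzm_parse_upper[of "stake N x" "stake N y" "L k"]
            by (simp add: mzm_count_def bad_def)
          then have "real (mzm_count N y x * L k) \<le> real (N + L k * (card bad + 1))" by (rule of_nat_mono)
          then have "C * real (L k) \<le> real N + real (L k) * (real (card bad) + 1)" by (simp add: C_def algebra_simps)
          moreover have Lk: "real (L k) > 0" using L_ge[of k] elim(4) by linarith
          ultimately have "C \<le> real N / real (L k) + (real (card bad) + 1)"
            by (simp add: field_simps)
          also have "real N / real (L k) \<le> real N / (real k * ln 2 / s - 1)"
            using L_ge[of k] elim(4) Lk by (intro divide_left_mono mult_pos_pos) auto
          also have "real (card bad) + 1 \<le> real N / (real k)\<^sup>2 + real N / 2 ^ k"
            using bad N_pos divide_right_mono[OF N_pos(3), of "(real k)\<^sup>2"] by (intro add_mono) auto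
          finally have "C \<le> real N * (1 / (real k * ln 2 / s - 1) + 1 / (real k)\<^sup>2 + 1 / 2 ^ k)"
            by (simp add: algebra_simps)
          then have C: "C / real N \<le> 1 / (real k * ln 2 / s - 1) + 1 / (real k)\<^sup>2 + 1 / 2 ^ k"
            using N_pos by (simp add: divide_le_eq mult.commute)
          have "real N < 2 ^ Suc k" using N by (metis of_nat_less_iff of_nat_numeral of_nat_power)
          then have "ln (real N) < ln (2 ^ Suc k)" using N_pos(1) by (subst ln_less_cancel_iff) simp_all
          then have ln: "ln (real N) \<le> (real k + 1) * ln 2"
            by (simp add: ln_realpow algebra_simps del: power_Suc)
          have "C / real N * ln (real N) \<le> (1 / (real k * ln 2 / s - 1) + 1 / (real k)\<^sup>2 + 1 / 2 ^ k) * ((real k + 1) * ln 2)"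
            using C ln N_pos elim(4) by (intro mult_mono) auto
          also have "\<dots> = g k" by (simp add: g_def)
          finally show "real (mzm_count N (snd z) (fst z)) * ln (real N) / real N < t"
            using elim(3) by (simp add: z C_def)
        qed
      qed
    qed
  qed
qed

text \<open>A first moment bound over pairs of positions: there are at most \<open>4 * 4 ^ k\<close>
  pairs, and the collision probability at length \<open>C * k\<close> decays faster than
  \<open>4 ^ k\<close> grows.\<close>

lemma AE_no_long_match:
  obtains C where "C > 0"
    "AE z in P \<Otimes>\<^sub>M Q. eventually (\<lambda>k. \<forall>j<2 ^ Suc k.
      \<not> sublist (stake (nat \<lceil>C * real k\<rceil>) (sdrop j (snd z))) (stake (2 ^ Suc k) (fst z))) sequentially"
proof -
  obtain c where c: "c > 0"
    "eventually (\<lambda>n. (\<Sum>a | length a = n. word_prob P a * word_prob Q a) \<le> exp (- c * real n)) sequentially"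
    using collision_bound .
  \<comment> \<open>The collision bound becomes \<open>exp (- 3 * k)\<close>; as
    \<open>4 ^ k \<le> exp (2 * k)\<close>, a factor \<open>exp (- k)\<close> is left.\<close>
  define C where "C = 3 / c"
  have C: "C > 0" "c * C = 3" using c by (simp_all add: C_def)
  define M where "M k = nat \<lceil>C * real k\<rceil>" for k
  have M_ge: "C * real k \<le> real (M k)" for k
    using real_nat_ceiling_ge[of "C * real k"] by (simp add: M_def)
  have M_top: "filterlim M at_top sequentially"
  proof -
    have "filterlim (\<lambda>k. C * real k) at_top sequentially" using C by real_asymp
    then have "filterlim (\<lambda>k. real (M k)) at_top sequentially"
      by (rule filterlim_at_top_mono) (use M_ge in auto)
    then show ?thesis by (simp add: filterlim_sequentially_iff_filterlim_real)
  qed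
  let ?E = "\<lambda>k z. \<exists>j<2 ^ Suc k. sublist (stake (M k) (sdrop j (snd z))) (stake (2 ^ Suc k) (fst z))"
  have "AE z in P \<Otimes>\<^sub>M Q. eventually (\<lambda>k. \<not> ?E k z) sequentially"
  proof (rule PQ.AE_eventually_not)
    show "Measurable.pred (P \<Otimes>\<^sub>M Q) (?E k)" for k
    proof -
      have [measurable]: "Measurable.pred (P \<Otimes>\<^sub>M Q)
          (\<lambda>z. sublist (stake (M k) (sdrop j (snd z))) (stake (2 ^ Suc k) (fst z)))" for j
        using pred_word_pair[of "\<lambda>u v. sublist v u" "2 ^ Suc k" 0 "M k" j] by simp
      show ?thesis by measurable
    qed
    show "summable (\<lambda>k. 4 * exp (- 1 :: real) ^ k)"
      by (intro summable_mult summable_geometric) simp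
    have "eventually (\<lambda>k. 1 \<le> M k) sequentially"
      using M_top by (simp add: filterlim_at_top)
    then show "eventually (\<lambda>k. PQ.prob {z \<in> space (P \<Otimes>\<^sub>M Q). ?E k z} \<le> 4 * exp (- 1) ^ k) sequentially"
      using eventually_compose_filterlim[OF c(2) M_top]
    proof eventually_elim
      case (elim k)
      let ?S = "\<lambda>j. {z. sublist (stake (M k) (sdrop j (snd z))) (stake (2 ^ Suc k) (fst z))}"
      have S_sets: "?S j \<in> sets (P \<Otimes>\<^sub>M Q)" for j
        using sets_word_pair[of "\<lambda>u v. sublist v u" "2 ^ Suc k" 0 "M k" j] by simp
      have S: "PQ.prob (?S j) \<le> 2 ^ Suc k * exp (- c * real (M k))" for j
      proof -
        have "PQ.prob (?S j) \<le> 2 ^ Suc k * (\<Sum>a | length a = M k. word_prob P a * word_prob Q a)"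
          using prob_occurs_le[of "M k" j "2 ^ Suc k" "\<lambda>_. True"] elim(1) by simp
        also have "\<dots> \<le> 2 ^ Suc k * exp (- c * real (M k))"
          using elim(2) by (intro mult_left_mono) auto
        finally show ?thesis .
      qed
      have "PQ.prob {z \<in> space (P \<Otimes>\<^sub>M Q). ?E k z} = PQ.prob (\<Union>j\<in>{..<2 ^ Suc k}. ?S j)"
        by (rule arg_cong[of _ _ PQ.prob]) auto
      also have "\<dots> \<le> (\<Sum>j\<in>{..<2 ^ Suc k}. PQ.prob (?S j))"
        using S_sets by (intro PQ.finite_measure_subadditive_finite) auto
      also have "\<dots> \<le> real (card {..<2 ^ Suc k :: nat}) * (2 ^ Suc k * exp (- c * real (M k)))"
        by (intro sum_bounded_above S)
      also have "\<dots> = 4 * (exp (real k * (2 * ln 2)) * exp (- c * real (M k)))"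
      proof -
        have "exp (real k * (2 * ln 2)) = (exp (ln 2) ^ 2 :: real) ^ k"
          by (simp only: exp_of_nat_mult exp_double)
        also have "\<dots> = 2 ^ k * 2 ^ k" by (simp flip: power_mult_distrib)
        finally have "exp (real k * (2 * ln 2)) = (2 ^ k * 2 ^ k :: real)" .
        then show ?thesis by simp
      qed
      also have "\<dots> = 4 * exp (real k * (2 * ln 2) - c * real (M k))"
        by (simp flip: exp_add)
      also have "\<dots> \<le> 4 * exp (real k * (- 1))"
      proof -
        have "c * (C * real k) \<le> c * real (M k)" using M_ge c by (intro mult_left_mono) auto
        then have "3 * real k \<le> c * real (M k)" by (simp only: mult.assoc[symmetric] C(2))
        moreover have "real k * (2 * ln 2) \<le> real k * 2"
          using ln_le_minus_one[of "2::real"] by (intro mult_left_mono) auto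
        ultimately show ?thesis by simp
      qed
      finally show ?case by (simp only: exp_of_nat_mult)
    qed
  qed
  then have "AE z in P \<Otimes>\<^sub>M Q. eventually (\<lambda>k. \<forall>j<2 ^ Suc k.
      \<not> sublist (stake (nat \<lceil>C * real k\<rceil>) (sdrop j (snd z))) (stake (2 ^ Suc k) (fst z))) sequentially"
    by (simp add: M_def)
  then show thesis using that[OF C(1)] by blast
qed

text \<open>At most positions of \<open>y\<close> the window of length about
  \<open>(k + 1) * ln 2 / s\<close> does not occur in \<open>x\<close>, so a word starting there has
  length at most \<open>L k\<close>. The few other words have length of order \<open>k\<close> by
  \<open>AE_no_long_match\<close> and cover only a vanishing fraction of \<open>y\<close>.\<close>

lemma AE_count_lower:
  assumes t: "0 < t" "t < h"
  shows "AE z in P \<Otimes>\<^sub>M Q. eventually (\<lambda>N. t < real (mzm_count N (snd z) (fst z)) * ln (real N) / real N) sequentially"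
proof -
  \<comment> \<open>Here \<open>t < s < r < h\<close>: windows above the threshold \<open>r\<close>
    are exceptional under \<open>Q\<close>, and \<open>s < r\<close> makes the remaining ones
    unlikely to occur in \<open>x\<close>.\<close>
  define s where "s = (h + t) / 2"
  define r where "r = (h + s) / 2"
  have s: "t < s" "s < h" "0 < s" and r: "s < r" "r < h" "0 < r" using t by (simp_all add: s_def r_def field_simps)
  \<comment> \<open>The exponent \<open>k + 1\<close> belongs to the upper end of the block, because
    \<open>x\<close> is searched up to length \<open>2 ^ Suc k\<close>.\<close>
  define L where "L k = nat \<lceil>(real k + 1) * ln 2 / s\<rceil>" for k
  obtain c where c: "c > 0"
    "eventually (\<lambda>n. Q.prob {y. exp (- r * real n) < word_prob P (stake n y)} \<le> exp (- c * real n)) sequentially"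
    using prob_frequent_word[OF r(2)] by blast
  obtain C where C: "C > 0"
    "AE z in P \<Otimes>\<^sub>M Q. eventually (\<lambda>k. \<forall>j<2 ^ Suc k.
      \<not> sublist (stake (nat \<lceil>C * real k\<rceil>) (sdrop j (snd z))) (stake (2 ^ Suc k) (fst z))) sequentially"
    using AE_no_long_match by blast
  define M where "M k = nat \<lceil>C * real k\<rceil>" for k
  have M_le: "real (M k) \<le> C * real k + 1" for k
    using C(1) of_int_ceiling_le_add_one[of "C * real k"] by (simp add: M_def)
  have L_ge: "(real k + 1) * ln 2 / s \<le> real (L k)" for k
    using real_nat_ceiling_ge[of "(real k + 1) * ln 2 / s"] by (simp add: L_def)
  have L_le: "real (L k) \<le> (real k + 1) * ln 2 / s + 1" for k
    using s of_int_ceiling_le_add_one[of "(real k + 1) * ln 2 / s"] by (simp add: L_def)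
  have L_pos: "L k > 0" for k
  proof -
    have "0 < (real k + 1) * ln 2 / s" using s by simp
    then show ?thesis using L_ge[of k] by linarith
  qed
  have L_top: "filterlim L at_top sequentially"
  proof -
    have "filterlim (\<lambda>k. (real k + 1) * ln 2 / s) at_top sequentially" using s by real_asymp
    then have "filterlim (\<lambda>k. real (L k)) at_top sequentially"
      by (rule filterlim_at_top_mono) (use L_ge in auto)
    then show ?thesis by (simp add: filterlim_sequentially_iff_filterlim_real)
  qed
  define occurs where "occurs k j z \<longleftrightarrow>
    sublist (stake (L k) (sdrop j (snd z))) (stake (2 ^ Suc k) (fst z))" for k j and z :: "'a stream \<times> 'a stream"
  \<comment> \<open>The smaller of two rates: that of a window being too frequent, and that of a
    window which is not too frequent occurring in \<open>x\<close>.\<close>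
  define \<gamma> where "\<gamma> = min (c * ln 2 / s) ((r / s - 1) * ln 2)"
  have \<gamma>: "\<gamma> > 0" "\<gamma> \<le> c * ln 2 / s" "\<gamma> \<le> (r / s - 1) * ln 2"
    using c s r by (auto simp: \<gamma>_def)
  have few: "AE z in P \<Otimes>\<^sub>M Q. eventually (\<lambda>k. real (card {j \<in> {..<2 ^ Suc k}. occurs k j z}) < 2 ^ k / (real k)\<^sup>2) sequentially"
  proof (rule PQ.AE_few_positions)
    show "Measurable.pred (P \<Otimes>\<^sub>M Q) (occurs k j)" for k j
      using pred_word_pair[of "\<lambda>u v. sublist v u" "2 ^ Suc k" 0 "L k" j] unfolding occurs_def by simp
    show "eventually (\<lambda>k. \<forall>j. PQ.prob {z \<in> space (P \<Otimes>\<^sub>M Q). occurs k j z} \<le> 2 * exp (- \<gamma> * real k)) sequentially"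
      using eventually_compose_filterlim[OF c(2) L_top]
    proof eventually_elim
      case (elim k)
      show ?case
      proof
        fix j
        let ?frequent = "\<lambda>a. exp (- r * real (L k)) < word_prob P a"
        let ?A = "{z. ?frequent (stake (L k) (sdrop j (snd z)))}"
        let ?B = "{z. sublist (stake (L k) (sdrop j (snd z))) (stake (2 ^ Suc k) (fst z))
          \<and> \<not> ?frequent (stake (L k) (sdrop j (snd z)))}"
        have A_sets: "?A \<in> sets (P \<Otimes>\<^sub>M Q)" and B_sets: "?B \<in> sets (P \<Otimes>\<^sub>M Q)"
          using sets_word_pair[of "\<lambda>u v. ?frequent v" 0 0 "L k" j]
            sets_word_pair[of "\<lambda>u v. sublist v u \<and> \<not> ?frequent v" "2 ^ Suc k" 0 "L k" j] by simp_all
        have "PQ.prob {z \<in> space (P \<Otimes>\<^sub>M Q). occurs k j z} \<le> PQ.prob (?A \<union> ?B)"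
          using A_sets B_sets by (intro PQ.finite_measure_mono) (auto simp: occurs_def)
        also have "\<dots> \<le> PQ.prob ?A + PQ.prob ?B"
          using A_sets B_sets by (rule measure_Un_le)
        also have "PQ.prob ?A \<le> exp (- \<gamma> * real k)"
        proof -
          have "PQ.prob ?A = measure (distr (P \<Otimes>\<^sub>M Q) Q snd) {y. ?frequent (stake (L k) (sdrop j y))}"
            by (subst measure_distr) (auto simp: vimage_def Q.sets_word[of ?frequent])
          also have "\<dots> = Q.prob {y. ?frequent (stake (L k) y)}"
            unfolding distr_snd Q.prob_word[of ?frequent] Q.prob_prefix[of ?frequent] ..
          also have "\<dots> \<le> exp (- c * real (L k))" by (rule elim)
          also have "\<dots> \<le> exp (- \<gamma> * real k)"
          proof -
            have "\<gamma> * real k \<le> (c * ln 2 / s) * (real k + 1)"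
              using \<gamma> by (intro mult_mono) auto
            also have "\<dots> = c * ((real k + 1) * ln 2 / s)" by simp
            also have "\<dots> \<le> c * real (L k)" using L_ge c by (intro mult_left_mono) auto
            finally show ?thesis by simp
          qed
          finally show ?thesis .
        qed
        also have "PQ.prob ?B \<le> exp (- \<gamma> * real k)"
        proof -
          have "PQ.prob ?B \<le> real (2 ^ Suc k) * (\<Sum>a | length a = L k \<and> \<not> ?frequent a. word_prob P a * word_prob Q a)"
            by (rule prob_occurs_le[OF L_pos])
          \<comment> \<open>The filter bounds the factor \<open>P\<close>, and the remaining
            \<open>Q\<close>-probabilities add up to at most 1.\<close>
          also have "(\<Sum>a | length a = L k \<and> \<not> ?frequent a. word_prob P a * word_prob Q a)
              \<le> (\<Sum>a | length a = L k \<and> \<not> ?frequent a. exp (- r * real (L k)) * word_prob Q a)"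
            by (intro sum_mono mult_right_mono) auto
          also have "\<dots> = exp (- r * real (L k)) * (\<Sum>a | length a = L k \<and> \<not> ?frequent a. word_prob Q a)"
            by (simp add: sum_distrib_left)
          also have "\<dots> \<le> exp (- r * real (L k)) * 1"
            using Q.prob_prefix[of "\<lambda>a. \<not> ?frequent a" "L k", symmetric] by (intro mult_left_mono) auto
          also have "real (2 ^ Suc k) = exp ((real k + 1) * ln 2)"
            using exp_of_nat_mult[of "Suc k" "ln 2 :: real"] by (simp add: algebra_simps)
          also have "exp ((real k + 1) * ln 2) * (exp (- r * real (L k)) * 1)
              = exp ((real k + 1) * ln 2 - r * real (L k))"
            by (simp flip: exp_add)
          also have "\<dots> \<le> exp (- \<gamma> * real k)"
          proof -
            have "\<gamma> * real k \<le> ((r / s - 1) * ln 2) * (real k + 1)"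
              using \<gamma> by (intro mult_mono) auto
            also have "\<dots> = r * ((real k + 1) * ln 2 / s) - (real k + 1) * ln 2"
              by (simp add: algebra_simps)
            also have "\<dots> \<le> r * real (L k) - (real k + 1) * ln 2"
              using mult_left_mono[OF L_ge[of k], of r] r by simp
            finally show ?thesis by simp
          qed
          finally show ?thesis by simp
        qed
        finally show "PQ.prob {z \<in> space (P \<Otimes>\<^sub>M Q). occurs k j z} \<le> 2 * exp (- \<gamma> * real k)" by simp
      qed
    qed
  qed (rule \<gamma>)
  \<comment> \<open>The inequality \<open>N \<le> K * L k + M k * card bad\<close> solved for
    \<open>K * ln N / N\<close>, with the estimates for block \<open>k\<close> inserted.\<close>
  define g where "g k = (1 - (C * real k + 1) / (real k)\<^sup>2) / ((real k + 1) * ln 2 / s + 1) * (real k * ln 2)" for k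
  have "g \<longlonglongrightarrow> s" unfolding g_def using s C(1) by real_asymp
  then have g: "eventually (\<lambda>k. t < g k) sequentially" using s by (intro order_tendstoD)
  have num: "eventually (\<lambda>k. 0 \<le> 1 - (C * real k + 1) / (real k)\<^sup>2) sequentially" using C(1) by real_asymp
  show ?thesis
    using C(2) few
  proof eventually_elim
    case (elim z)
    obtain x y where z: "z = (x, y)" by (cases z)
    show ?case
    proof (rule eventually_dyadic)
      show "eventually (\<lambda>k. \<forall>N. 2 ^ k \<le> N \<and> N < 2 ^ Suc k \<longrightarrow>
          t < real (mzm_count N (snd z) (fst z)) * ln (real N) / real N) sequentially"
        using elim g num eventually_gt_at_top[of 0]
      proof eventually_elim
        case (elim k)
        show ?case
        proof (intro allI impI)
          fix N :: nat assume N: "2 ^ k \<le> N \<and> N < 2 ^ Suc k"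
          have N_pos: "real N > 0" "real N \<ge> 1" "(2::real) ^ k \<le> real N"
            using N one_le_power[of "2::nat" k] by (auto simp: numeral_power_le_of_nat_cancel_iff)
          have N_sub: "sublist w (stake (2 ^ Suc k) x)" if "sublist w (stake N x)" for w
            using that N unfolding sublist_stake_iff by (meson order_trans less_imp_le)
          have word: "take l (drop j (stake N y)) = stake l (sdrop j y)" if "j + l \<le> N" for l j
            using that by (simp add: drop_stake take_stake min_absorb1)
          have "M k > 0" using C(1) elim(5) by (simp add: M_def)
          have short: "\<not> sublist (take (M k) (drop j (stake N y))) (stake N x)"
            if "j + M k \<le> length (stake N y)" for j
          proof -
            have "j < 2 ^ Suc k" using that N \<open>M k > 0\<close> by simp
            then have "\<not> sublist (stake (M k) (sdrop j y)) (stake (2 ^ Suc k) x)"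
              using elim(1) by (simp add: z M_def)
            then show ?thesis using N_sub that by (auto simp: word)
          qed
          define bad where "bad = {j. j < length (stake N y) \<and> j + L k \<le> length (stake N y)
            \<and> sublist (take (L k) (drop j (stake N y))) (stake N x)}"
          have "bad \<subseteq> {j \<in> {..<2 ^ Suc k}. occurs k j z}"
          proof
            fix j assume j: "j \<in> bad"
            then have "sublist (stake (L k) (sdrop j y)) (stake N x)"
              using word[of j "L k"] by (simp add: bad_def)
            then show "j \<in> {j \<in> {..<2 ^ Suc k}. occurs k j z}"
              using j N N_sub by (simp add: bad_def occurs_def z)
          qed
          then have "card bad \<le> card {j \<in> {..<2 ^ Suc k}. occurs k j z}" by (intro card_mono) auto
          then have bad: "real (card bad) \<le> 2 ^ k / (real k)\<^sup>2" using elim(2) by simp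
          define K where "K = real (mzm_count N y x)"
          have "N \<le> mzm_count N y x * L k + M k * card bad"
            using length_mzm_parse_lower[OF short, where L = "L k"]
            by (simp add: mzm_count_def bad_def)
          then have "real N \<le> real (mzm_count N y x * L k + M k * card bad)" by (rule of_nat_mono)
          then have "real N \<le> K * real (L k) + real (M k) * real (card bad)" by (simp add: K_def)
          also have "K * real (L k) \<le> K * ((real k + 1) * ln 2 / s + 1)"
            using L_le by (intro mult_left_mono) (auto simp: K_def)
          also have "real (M k) * real (card bad) \<le> (C * real k + 1) * (real N / (real k)\<^sup>2)"
          proof (intro mult_mono M_le)
            show "real (card bad) \<le> real N / (real k)\<^sup>2"
              using bad divide_right_mono[OF N_pos(3), of "(real k)\<^sup>2"] by simp
          qed (use C(1) in auto)
          finally have "real N * (1 - (C * real k + 1) / (real k)\<^sup>2) \<le> K * ((real k + 1) * ln 2 / s + 1)"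
            by (simp add: algebra_simps)
          moreover have "(real k + 1) * ln 2 / s + 1 > 0" using s by (simp add: add_pos_pos)
          ultimately have "(1 - (C * real k + 1) / (real k)\<^sup>2) / ((real k + 1) * ln 2 / s + 1) \<le> K / real N"
            using N_pos by (simp add: divide_le_eq le_divide_eq mult.commute)
          moreover have "real k * ln 2 \<le> ln (real N)"
          proof -
            have "ln (2 ^ k) \<le> ln (real N)" using N_pos(1,3) by (subst ln_le_cancel_iff) simp_all
            then show ?thesis by (simp add: ln_realpow)
          qed
          ultimately have "g k \<le> K / real N * ln (real N)"
            unfolding g_def by (intro mult_mono) (auto simp: K_def)
          then show "t < real (mzm_count N (snd z) (fst z)) * ln (real N) / real N"
            using elim(3) by (simp add: z K_def)
        qed
      qed
    qed
  qed
qed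

text \<open>Countably many thresholds on either side of \<open>h\<close> allow the null sets to be
  united. \<open>Suc (Suc n)\<close> keeps the lower thresholds strictly positive.\<close>

lemma AE_count_tendsto:
  assumes "selectively_lower_decoupled P"
  shows "AE z in P \<Otimes>\<^sub>M Q. (\<lambda>N. real (mzm_count N (snd z) (fst z)) * ln (real N) / real N) \<longlonglongrightarrow> h"
proof -
  have "AE z in P \<Otimes>\<^sub>M Q. \<forall>n. eventually (\<lambda>N. real (mzm_count N (snd z) (fst z)) * ln (real N) / real N
      < h + 1 / real (Suc n)) sequentially"
    by (subst AE_all_countable) (intro allI AE_count_upper assms, simp)
  moreover have "AE z in P \<Otimes>\<^sub>M Q. \<forall>n. eventually (\<lambda>N. h * (1 - 1 / real (Suc (Suc n)))
      < real (mzm_count N (snd z) (fst z)) * ln (real N) / real N) sequentially"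
    by (subst AE_all_countable) (intro allI AE_count_lower mult_pos_pos h_pos, use h_pos in \<open>simp_all add: mult_less_cancel_left2 del: of_nat_Suc\<close>)
  ultimately show ?thesis
  proof eventually_elim
    case (elim z)
    show ?case
    proof (rule order_tendstoI)
      fix b assume "h < b"
      moreover have "(\<lambda>n. h + 1 / real (Suc n)) \<longlonglongrightarrow> h" by real_asymp
      ultimately obtain n where "h + 1 / real (Suc n) < b"
        using order_tendstoD(2) eventually_happens sequentially_bot by blast
      then show "eventually (\<lambda>N. real (mzm_count N (snd z) (fst z)) * ln (real N) / real N < b) sequentially"
        using elim(1)[rule_format, of n] by (auto elim: eventually_mono)
    next
      fix b assume "b < h"
      moreover have "(\<lambda>n. h * (1 - 1 / real (Suc (Suc n)))) \<longlonglongrightarrow> h" by real_asymp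
      ultimately obtain n where "b < h * (1 - 1 / real (Suc (Suc n)))"
        using order_tendstoD(1) eventually_happens sequentially_bot by blast
      then show "eventually (\<lambda>N. b < real (mzm_count N (snd z) (fst z)) * ln (real N) / real N) sequentially"
        using elim(2)[rule_format, of n] by (auto elim: eventually_mono)
    qed
  qed
qed

end

text \<open>Dividing by \<open>ln N\<close> shows that \<open>K N / N\<close> tends to 0. The
  denominators \<open>N\<close> and \<open>N - K N\<close> are then asymptotically equal, and the
  infinite case of the estimator is eventually excluded.\<close>

lemma mzm_estimator_tendsto:
  assumes "(\<lambda>N. real (mzm_count N y x) * ln (real N) / real N) \<longlonglongrightarrow> h"
  shows "(\<lambda>N. mzm_estimator N y x) \<longlonglongrightarrow> ereal h"
proof -
  define K where "K N = real (mzm_count N y x)" for N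
  have lim: "(\<lambda>N. K N * ln (real N) / real N) \<longlonglongrightarrow> h" using assms by (simp add: K_def)
  have "(\<lambda>N. 1 / ln (real N)) \<longlonglongrightarrow> 0" by real_asymp
  from tendsto_mult[OF lim this]
  have "(\<lambda>N. K N * ln (real N) / real N * (1 / ln (real N))) \<longlonglongrightarrow> 0" by simp
  then have density: "(\<lambda>N. K N / real N) \<longlonglongrightarrow> 0"
    by (rule Lim_transform_eventually) (auto intro!: eventually_mono[OF eventually_gt_at_top[of 1]])
  have "(\<lambda>N. (K N * ln (real N) / real N) / (1 - K N / real N)) \<longlonglongrightarrow> h / (1 - 0)"
    using lim density by (intro tendsto_intros) auto
  then have "(\<lambda>N. ereal ((K N * ln (real N) / real N) / (1 - K N / real N))) \<longlonglongrightarrow> ereal h" by simp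
  moreover have "eventually (\<lambda>N. K N / real N < 1) sequentially"
    using density by (rule order_tendstoD) simp
  then have "eventually (\<lambda>N. ereal ((K N * ln (real N) / real N) / (1 - K N / real N)) = mzm_estimator N y x) sequentially"
    using eventually_gt_at_top[of 0]
  proof eventually_elim
    case (elim N)
    then have "mzm_count N y x \<noteq> N" by (auto simp: K_def)
    moreover have "(K N * ln (real N) / real N) / (1 - K N / real N) = K N * ln (real N) / (real N - K N)"
      using elim by (simp add: divide_simps)
    ultimately show ?case by (simp add: mzm_estimator_def K_def)
  qed
  ultimately show ?thesis by (rule Lim_transform_eventually)
qed

theorem corollary2p9:
  fixes P Q :: "'a::finite stream measure"
    and q :: "real \<Rightarrow> real" and I :: "real set"
  assumes "prob_space P" and "sets P = sets seq_space" and "shift_invariant P"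
    and "prob_space Q" and "sets Q = sets seq_space" and "shift_invariant Q"
    and "selectively_lower_decoupled P" and "upper_decoupled P"
    and "upper_decoupled Q"
    and "nondegenerate P Q"
    and "supp Q \<subseteq> supp P"
    and "open I" and "is_interval I" and "0 \<in> I"
    and "\<And>\<alpha>. \<alpha> \<in> I \<Longrightarrow> (\<lambda>n. pressure_n P Q n \<alpha> / ereal (real n)) \<longlonglongrightarrow> ereal (q \<alpha>)"
    and "q differentiable (at 0)"
  shows "AE (x, y) in P \<Otimes>\<^sub>M Q. (\<lambda>N. mzm_estimator N y x) \<longlonglongrightarrow> cross_entropy Q P"
proof -
  obtain h where h: "(q has_real_derivative h) (at 0)"
    using assms(16) by (auto simp: real_differentiable_def)
  interpret P: prob_space P by fact
  interpret Q: prob_space Q by fact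
  interpret differentiable_pressure P Q q I h
    by unfold_locales (use assms h in auto)
  show ?thesis
    using AE_count_tendsto[OF assms(7)]
    by eventually_elim (auto simp: cross_entropy_eq split_beta intro!: mzm_estimator_tendsto)
qed

end
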